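(* There exists an infinitely generated torsion-free Fuchsian group $\Gamma<\mathrm{Isom}^+(\mathbb{H})$ such that ${\rm HD}(\Lambda^\tau_\Gamma)=0$.
   Context: $\mathbb{H}$ is the hyperbolic plane, with boundary at infinity $\partial_\infty\mathbb{H}$. Fix $o\in\mathbb{H}$. The limit set is $\Lambda_\Gamma=\overline{\Gamma\cdot o}\setminus\Gamma\cdot o$. For $\xi\in\partial_\infty\mathbb{H}$ let $\xi_t$ be the point of the geodesic ray $[o,\xi)$ at distance $t$ from $o$ and $\Delta(\xi_t)=d(\xi_t,\Gamma\cdot o)$. The transient limit set is $\Lambda^\tau_\Gamma=\{\xi\in\Lambda_\Gamma:\lim_{t\to\infty}\Delta(\xi_t)=\infty\}$. Hausdorff dimension is taken with respect to a visual metric on the boundary (equivalently, the Euclidean metric on $\mathbb{R}$ in the upper half-plane model, locally). *)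

theory Defs
  imports "HOL-Analysis.Analysis"
begin

definition uhp :: "complex set" where
  "uhp = {z. Im z > 0}"

definition hdist :: "complex \<Rightarrow> complex \<Rightarrow> real" where
  "hdist z w = arcosh (1 + (cmod (z - w))^2 / (2 * Im z * Im w))"

section \<open>Isom+(H) = PSL(2,R); groups represented by their full preimage in SL(2,R)\<close>

type_synonym mat2 = "real^2^2"

definition SL2 :: "mat2 set" where
  "SL2 = {A. det A = 1}"

definition act :: "mat2 \<Rightarrow> complex \<Rightarrow> complex" where
  "act A z = (of_real (A$1$1) * z + of_real (A$1$2)) / (of_real (A$2$1) * z + of_real (A$2$2))"

definition sl2_subgroup :: "mat2 set \<Rightarrow> bool" where
  "sl2_subgroup G \<longleftrightarrow> G \<subseteq> SL2 \<and> mat 1 \<in> G \<and>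
     (\<forall>A\<in>G. \<forall>B\<in>G. A ** B \<in> G) \<and> (\<forall>A\<in>G. matrix_inv A \<in> G)"

definition sl2_generated :: "mat2 set \<Rightarrow> mat2 set" where
  "sl2_generated S = \<Inter>{H. sl2_subgroup H \<and> S \<subseteq> H}"

fun mpow :: "mat2 \<Rightarrow> nat \<Rightarrow> mat2" where
  "mpow A 0 = mat 1"
| "mpow A (Suc n) = A ** mpow A n"

text \<open>A subgroup \<open>\<Gamma>\<close> of PSL(2,R) is represented by its preimage \<open>G\<close> in SL(2,R),
  i.e. a subgroup of SL(2,R) containing \<open>-I\<close>.\<close>
definition psl2_subgroup :: "mat2 set \<Rightarrow> bool" where
  "psl2_subgroup G \<longleftrightarrow> sl2_subgroup G \<and> - mat 1 \<in> G"

definition fuchsian :: "mat2 set \<Rightarrow> bool" where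
  "fuchsian G \<longleftrightarrow> psl2_subgroup G \<and>
     (\<exists>\<epsilon>>0. \<forall>A\<in>G. A \<noteq> mat 1 \<longrightarrow> norm (A - mat 1) \<ge> \<epsilon>)"

text \<open>Torsion-free as a subgroup of PSL(2,R): no nontrivial element of finite order.\<close>
definition torsion_free :: "mat2 set \<Rightarrow> bool" where
  "torsion_free G \<longleftrightarrow> (\<forall>A\<in>G. \<forall>n>0. mpow A n \<in> {mat 1, - mat 1} \<longrightarrow> A \<in> {mat 1, - mat 1})"

text \<open>Finitely generated (as G contains -I, equivalent to finite generation of G/{+-I}).\<close>
definition finitely_generated :: "mat2 set \<Rightarrow> bool" where
  "finitely_generated G \<longleftrightarrow> (\<exists>S. finite S \<and> G = sl2_generated S)"

section \<open>Boundary at infinity: R \<union> {\<infinity>}, with None = \<infinity>\<close>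

type_synonym bdry = "real option"

definition conv_bdry :: "'b filter \<Rightarrow> ('b \<Rightarrow> complex) \<Rightarrow> bdry \<Rightarrow> bool" where
  "conv_bdry F f \<xi> = (case \<xi> of
      None \<Rightarrow> filterlim (\<lambda>t. cmod (f t)) at_top F
    | Some x \<Rightarrow> (f \<longlongrightarrow> complex_of_real x) F)"

definition orbit :: "mat2 set \<Rightarrow> complex \<Rightarrow> complex set" where
  "orbit G x0 = (\<lambda>A. act A x0) ` G"

definition limit_set :: "mat2 set \<Rightarrow> complex \<Rightarrow> bdry set" where
  "limit_set G x0 = {\<xi>. \<exists>p::nat \<Rightarrow> complex. (\<forall>n. p n \<in> orbit G x0) \<and> conv_bdry sequentially p \<xi>}"

definition orbit_dist :: "mat2 set \<Rightarrow> complex \<Rightarrow> complex \<Rightarrow> real" where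
  "orbit_dist G x0 p = Inf ((\<lambda>q. hdist p q) ` orbit G x0)"

definition geodesic_ray :: "complex \<Rightarrow> (real \<Rightarrow> complex) \<Rightarrow> bool" where
  "geodesic_ray x0 r \<longleftrightarrow> r 0 = x0 \<and> (\<forall>t\<ge>0. r t \<in> uhp) \<and>
     (\<forall>s\<ge>0. \<forall>t\<ge>0. hdist (r s) (r t) = \<bar>s - t\<bar>)"

definition transient_limit_set :: "mat2 set \<Rightarrow> complex \<Rightarrow> bdry set" where
  "transient_limit_set G x0 = {\<xi> \<in> limit_set G x0. \<forall>r. geodesic_ray x0 r \<and> conv_bdry at_top r \<xi> \<longrightarrow>
      filterlim (\<lambda>t. orbit_dist G x0 (r t)) at_top at_top}"

definition hausdorff_pre :: "real \<Rightarrow> real \<Rightarrow> real set \<Rightarrow> ennreal" where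
  "hausdorff_pre s \<delta> A = (INF U \<in> {U :: nat \<Rightarrow> real set. A \<subseteq> (\<Union>i. U i) \<and>
        (\<forall>i. bounded (U i) \<and> diameter (U i) \<le> \<delta>)}.
      (\<Sum>i. ennreal (diameter (U i) powr s)))"

definition hausdorff_measure :: "real \<Rightarrow> real set \<Rightarrow> ennreal" where
  "hausdorff_measure s A = (SUP \<delta> \<in> {0<..}. hausdorff_pre s \<delta> A)"

definition hausdorff_dim :: "real set \<Rightarrow> real" where
  "hausdorff_dim A = Inf {s. s > 0 \<and> hausdorff_measure s A = 0}"

text \<open>Hausdorff dimension of a subset of the boundary: of its finite part in R
  (the point \<infinity> does not affect the dimension).\<close>
definition bdry_hausdorff_dim :: "bdry set \<Rightarrow> real" where
  "bdry_hausdorff_dim X = hausdorff_dim {x. Some x \<in> X}"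

end

theory Submission
  imports Defs
begin

text \<open>
  The group is an infinitely generated Schottky group inside the level-2 congruence subgroup, so it is
  discrete and torsion-free; ping-pong on disjoint discs accumulating only at infinity shows that it is
  not finitely generated. A finite limit point either is in the orbit of infinity or has an infinite
  itinerary \<open>l\<^sub>0, l\<^sub>1, \<dots>\<close> of generators. If some letter with \<open>|l\<^sub>k| < N\<close> occurs infinitely often,
  the geodesic ray returns infinitely often to a bounded part of the quotient. Hence for every \<open>N\<close> a
  transient limit point has, up to countably many points, only letters of absolute value at least \<open>N\<close>
  from some time on. The generators \<open>j\<close> contract by \<open>4\<^bsup>-|j|\<^esup>\<close>, which is summable to
  any power \<open>s > 0\<close>, so the limit set of the letters beyond \<open>N\<close> has vanishing \<open>s\<close>-dimensional
  Hausdorff measure once \<open>N\<close> is large.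
\<close>

section \<open>Hausdorff null sets\<close>

text \<open>The generators have to meet two demands. Integer entries congruent to the identity
  modulo 2 let arithmetic settle discreteness and torsion; strong contraction makes the large
  letters negligible in every dimension. Lower left entries of size 2^|j| serve both: they are even
  integers, and 4^(-|j| s) has a finite sum over j for each s > 0, whereas polynomial growth would
  leave a threshold on s. Translation by 2j keeps the centres uniformly apart. The cutoff
  \<open>N\<close> depends on s, so the statement about eventually large letters is needed for every
  \<open>N\<close>; passing from "eventually" to "always" costs only countably many Lipschitz
  images, which keep null sets null. The base point is arbitrary while ping-pong is played from
  \<i>. This is bridged twice: \<open>limit_set_disc\<close> compares the two orbits near the real
  line, and \<open>escape\<close> shows that the images of the base point along an itinerary
  eventually leave the neighbourhood of the next centre. From then on their heights decay
  geometrically, which produces the late return times in the recurrence argument.\<close>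

definition hausdorff_null :: "real \<Rightarrow> real set \<Rightarrow> bool" where
  "hausdorff_null s A \<longleftrightarrow> (\<forall>\<epsilon>>0. \<exists>U::nat \<Rightarrow> real set. A \<subseteq> (\<Union>i. U i) \<and> (\<forall>i. bounded (U i)) \<and>
     (\<Sum>i. ennreal (diameter (U i) powr s)) \<le> ennreal \<epsilon>)"

lemma hausdorff_null_subset: "hausdorff_null s B \<Longrightarrow> A \<subseteq> B \<Longrightarrow> hausdorff_null s A"
  unfolding hausdorff_null_def by (meson subset_trans)

lemma suminf_prod_decode:
  fixes h :: "nat \<Rightarrow> nat \<Rightarrow> ennreal"
  shows "(\<Sum>k. case_prod h (prod_decode k)) = (\<Sum>n. \<Sum>i. h n i)"
  using suminf_ennreal_2dimen[of "\<lambda>n. \<Sum>i. h n i" "case_prod h"] by (simp add: o_def)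

lemma hausdorff_null_UN:
  assumes "\<And>n::nat. hausdorff_null s (A n)"
  shows "hausdorff_null s (\<Union>n. A n)"
  unfolding hausdorff_null_def
proof (intro allI impI)
  fix \<epsilon> :: real assume e: "\<epsilon> > 0"
  have "\<forall>n. \<exists>U::nat \<Rightarrow> real set. A n \<subseteq> (\<Union>i. U i) \<and> (\<forall>i. bounded (U i)) \<and>
     (\<Sum>i. ennreal (diameter (U i) powr s)) \<le> ennreal (\<epsilon> * (1/2)^Suc n)"
    using assms e unfolding hausdorff_null_def by simp
  then obtain U where U: "\<And>n. A n \<subseteq> (\<Union>i. U n i)" "\<And>n i. bounded (U n i)"
     "\<And>n. (\<Sum>i. ennreal (diameter (U n i :: real set) powr s)) \<le> ennreal (\<epsilon> * (1/2)^Suc n)"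
    by metis
  define V where "V k = (case prod_decode k of (n, i) \<Rightarrow> U n i)" for k
  have V: "V (prod_encode (n, i)) = U n i" for n i by (simp add: V_def)
  have "(\<Sum>k. ennreal (diameter (V k) powr s)) = (\<Sum>n. \<Sum>i. ennreal (diameter (U n i) powr s))"
    unfolding suminf_prod_decode[symmetric]
      by (intro suminf_cong) (simp add: V_def split: prod.splits)
  also have "\<dots> \<le> (\<Sum>n. ennreal (\<epsilon> * (1/2)^Suc n))"
    using U(3) by (intro suminf_le) auto
  also have "\<dots> = ennreal (\<Sum>n. \<epsilon> * (1/2)^Suc n)"
    using e by (intro suminf_ennreal2) auto
  also have "(\<Sum>n. \<epsilon> * (1/2)^Suc n) = \<epsilon>"
    using sums_mult[OF power_half_series, of \<epsilon>] by (simp add: sums_iff)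
  finally have 1: "(\<Sum>k. ennreal (diameter (V k) powr s)) \<le> ennreal \<epsilon>" .
  have 2: "(\<Union>n. A n) \<subseteq> (\<Union>k. V k)"
  proof
    fix x assume "x \<in> (\<Union>n. A n)"
    then obtain n i where "x \<in> U n i" using U(1) by blast
    then have "x \<in> V (prod_encode (n, i))" unfolding V .
    then show "x \<in> (\<Union>k. V k)" by blast
  qed
  have "\<forall>i. bounded (V i)" using U(2) by (auto simp: V_def split: prod.splits)
  with 1 2 show "\<exists>U::nat \<Rightarrow> real set. (\<Union>n. A n) \<subseteq> (\<Union>i. U i) \<and> (\<forall>i. bounded (U i)) \<and>
     (\<Sum>i. ennreal (diameter (U i) powr s)) \<le> ennreal \<epsilon>" by blast
qed

lemma hausdorff_null_singleton: "hausdorff_null s {x}"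
  unfolding hausdorff_null_def by (intro allI impI exI[of _ "\<lambda>_. {x}"]) auto

lemma hausdorff_null_empty: "hausdorff_null s {}"
  by (rule hausdorff_null_subset[OF hausdorff_null_singleton]) simp

lemma hausdorff_null_UN_countable:
  assumes "countable I" "\<And>i. i \<in> I \<Longrightarrow> hausdorff_null s (A i)"
  shows "hausdorff_null s (\<Union>i\<in>I. A i)"
proof (cases "I = {}")
  case True then show ?thesis by (simp add: hausdorff_null_empty)
next
  case False
  then have r: "range (from_nat_into I) = I" using assms(1) by (rule range_from_nat_into)
  have "hausdorff_null s (\<Union>n. A (from_nat_into I n))"
    by (rule hausdorff_null_UN) (use assms(2) r in blast)
  moreover have "(\<Union>n. A (from_nat_into I n)) = (\<Union>i\<in>I. A i)"
    by (metis image_image r)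
  ultimately show ?thesis by simp
qed

lemma hausdorff_null_Un:
  assumes "hausdorff_null s A" "hausdorff_null s B"
  shows "hausdorff_null s (A \<union> B)"
  using hausdorff_null_UN_countable[of "{A, B}" s "\<lambda>X. X"] assms by auto

lemma diameter_Lipschitz_image_le:
  fixes f :: "real \<Rightarrow> real"
  assumes "bounded U" "\<rho> \<ge> 0"
    and "\<And>x y. x \<in> F \<Longrightarrow> y \<in> F \<Longrightarrow> \<bar>f x - f y\<bar> \<le> \<rho> * \<bar>x - y\<bar>"
  shows "bounded (f ` (U \<inter> F))" "diameter (f ` (U \<inter> F)) \<le> \<rho> * diameter U"
proof -
  have d: "\<bar>f x - f y\<bar> \<le> \<rho> * diameter U" if "x \<in> U \<inter> F" "y \<in> U \<inter> F" for x y
  proof -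
    have "\<bar>x - y\<bar> \<le> diameter U"
      using diameter_bounded_bound[OF assms(1), of x y] that by (simp add: dist_real_def)
    then have "\<rho> * \<bar>x - y\<bar> \<le> \<rho> * diameter U" using assms(2) by (rule mult_left_mono)
    with assms(3)[of x y] that show ?thesis by auto
  qed
  show "bounded (f ` (U \<inter> F))"
    unfolding bounded_two_points using d by (auto simp: dist_real_def)
  show "diameter (f ` (U \<inter> F)) \<le> \<rho> * diameter U"
    by (rule diameter_le)
       (use d assms(2) diameter_ge_0[OF assms(1)] in auto)
qed

lemma hausdorff_null_Lipschitz_image:
  fixes f :: "real \<Rightarrow> real"
  assumes "hausdorff_null s A" "s > 0" "\<rho> > 0"
    and L: "\<And>x y. x \<in> F \<Longrightarrow> y \<in> F \<Longrightarrow> \<bar>f x - f y\<bar> \<le> \<rho> * \<bar>x - y\<bar>"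
  shows "hausdorff_null s (f ` (A \<inter> F))"
  unfolding hausdorff_null_def
proof (intro allI impI)
  fix \<epsilon> :: real assume e: "\<epsilon> > 0"
  then have "\<epsilon> / \<rho> powr s > 0" using assms(3) by simp
  then obtain U :: "nat \<Rightarrow> real set" where U: "A \<subseteq> (\<Union>i. U i)" "\<And>i. bounded (U i)"
     "(\<Sum>i. ennreal (diameter (U i) powr s)) \<le> ennreal (\<epsilon> / \<rho> powr s)"
    using assms(1) unfolding hausdorff_null_def by blast
  have D: "bounded (f ` (U i \<inter> F))" "diameter (f ` (U i \<inter> F)) \<le> \<rho> * diameter (U i)" for i
    by (rule diameter_Lipschitz_image_le[OF U(2) less_imp_le[OF assms(3)] L]; assumption)+
  have "(\<Sum>i. ennreal (diameter (f ` (U i \<inter> F)) powr s))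
      \<le> (\<Sum>i. ennreal (\<rho> powr s) * ennreal (diameter (U i) powr s))"
  proof (intro suminf_le)
    fix i
    have "diameter (f ` (U i \<inter> F)) powr s \<le> (\<rho> * diameter (U i)) powr s"
      using D assms(2) by (intro powr_mono2 diameter_ge_0) auto
    also have "\<dots> = \<rho> powr s * diameter (U i) powr s"
      using assms(3) diameter_ge_0[OF U(2)] by (simp add: powr_mult)
    finally show "ennreal (diameter (f ` (U i \<inter> F)) powr s) \<le> ennreal (\<rho> powr s) * ennreal (diameter (U i) powr s)"
      by (simp add: ennreal_leI flip: ennreal_mult)
  qed auto
  also have "\<dots> = ennreal (\<rho> powr s) * (\<Sum>i. ennreal (diameter (U i) powr s))"
    by simp
  also have "\<dots> \<le> ennreal (\<rho> powr s) * ennreal (\<epsilon> / \<rho> powr s)"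
    using U(3) by (rule mult_left_mono) simp
  also have "\<dots> = ennreal \<epsilon>" using e assms(3) by (simp flip: ennreal_mult)
  finally have "(\<Sum>i. ennreal (diameter (f ` (U i \<inter> F)) powr s)) \<le> ennreal \<epsilon>" .
  moreover have "f ` (A \<inter> F) \<subseteq> (\<Union>i. f ` (U i \<inter> F))"
  proof
    fix z assume "z \<in> f ` (A \<inter> F)"
    then obtain y where y: "z = f y" "y \<in> A" "y \<in> F" by auto
    then obtain i where "y \<in> U i" using U(1) by auto
    with y show "z \<in> (\<Union>i. f ` (U i \<inter> F))" by auto
  qed
  moreover have "\<forall>i. bounded (f ` (U i \<inter> F))" using D(1) by simp
  ultimately show "\<exists>U::nat \<Rightarrow> real set. f ` (A \<inter> F) \<subseteq> (\<Union>i. U i) \<and> (\<forall>i. bounded (U i)) \<and>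
     (\<Sum>i. ennreal (diameter (U i) powr s)) \<le> ennreal \<epsilon>"
    by (intro exI[of _ "\<lambda>i. f ` (U i \<inter> F)"] conjI)
qed

text \<open>Each pass through the self-covering multiplies the cost of a cover by at most \<open>1/2\<close>.\<close>
lemma hausdorff_null_self_cover:
  fixes f :: "nat \<Rightarrow> real \<Rightarrow> real"
  assumes s: "s > 0"
    and \<rho>: "\<And>i. \<rho> i \<ge> 0" "(\<Sum>i. ennreal (\<rho> i powr s)) \<le> ennreal (1/2)"
    and L: "\<And>i x y. x \<in> F i \<Longrightarrow> y \<in> F i \<Longrightarrow> \<bar>f i x - f i y\<bar> \<le> \<rho> i * \<bar>x - y\<bar>"
    and self: "S \<subseteq> (\<Union>i. f i ` (S \<inter> F i))"
    and U0: "S \<subseteq> (\<Union>i. U0 i)" "\<And>i::nat. bounded (U0 i)"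
      "(\<Sum>i. ennreal (diameter (U0 i) powr s)) \<le> ennreal C"
  shows "hausdorff_null s S"
proof -
  have step: "\<exists>U::nat \<Rightarrow> real set. S \<subseteq> (\<Union>i. U i) \<and> (\<forall>i. bounded (U i)) \<and>
     (\<Sum>i. ennreal (diameter (U i) powr s)) \<le> ennreal ((1/2)^k) * ennreal C" for k
  proof (induction k)
    case 0 then show ?case using U0 by (intro exI[of _ U0]) auto
  next
    case (Suc k)
    then obtain U :: "nat \<Rightarrow> real set" where U: "S \<subseteq> (\<Union>i. U i)" "\<And>i. bounded (U i)"
     "(\<Sum>i. ennreal (diameter (U i) powr s)) \<le> ennreal ((1/2)^k) * ennreal C" by blast
    define W where "W n i = f n ` (U i \<inter> F n)" for n i
    define V where "V k = (case prod_decode k of (n, i) \<Rightarrow> W n i)" for k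
    have V: "V (prod_encode (n, i)) = W n i" for n i by (simp add: V_def)
    have D: "bounded (W n i)" "diameter (W n i) \<le> \<rho> n * diameter (U i)" for n i
      unfolding W_def by (rule diameter_Lipschitz_image_le[OF U(2) \<rho>(1) L]; assumption)+
    have "(\<Sum>k. ennreal (diameter (V k) powr s)) = (\<Sum>n. \<Sum>i. ennreal (diameter (W n i) powr s))"
      unfolding suminf_prod_decode[symmetric]
      by (intro suminf_cong) (simp add: V_def split: prod.splits)
    also have "\<dots> \<le> (\<Sum>n. \<Sum>i. ennreal (\<rho> n powr s) * ennreal (diameter (U i) powr s))"
    proof (intro suminf_le)
      fix n i
      have "diameter (W n i) powr s \<le> (\<rho> n * diameter (U i)) powr s"
        using D s by (intro powr_mono2 diameter_ge_0) auto
      also have "\<dots> = \<rho> n powr s * diameter (U i) powr s"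
        using \<rho>(1) diameter_ge_0[OF U(2)] by (simp add: powr_mult)
      finally show "ennreal (diameter (W n i) powr s) \<le> ennreal (\<rho> n powr s) * ennreal (diameter (U i) powr s)"
        by (simp add: ennreal_leI flip: ennreal_mult)
    qed auto
    also have "\<dots> = (\<Sum>n. ennreal (\<rho> n powr s)) * (\<Sum>i. ennreal (diameter (U i) powr s))"
      by simp
    also have "\<dots> \<le> ennreal (1/2) * (ennreal ((1/2)^k) * ennreal C)"
      using \<rho>(2) U(3) by (rule mult_mono) auto
    also have "\<dots> = ennreal ((1/2)^Suc k) * ennreal C"
      unfolding power_Suc mult.assoc[symmetric] by (subst ennreal_mult) auto
    finally have 1: "(\<Sum>k. ennreal (diameter (V k) powr s)) \<le> ennreal ((1/2)^Suc k) * ennreal C" .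
    have "S \<subseteq> (\<Union>k. V k)"
    proof
      fix x assume "x \<in> S"
      then obtain n y where y: "x = f n y" "y \<in> S" "y \<in> F n" using self by blast
      then obtain i where "y \<in> U i" using U(1) by blast
      with y have "x \<in> V (prod_encode (n, i))" unfolding V W_def by blast
      then show "x \<in> (\<Union>k. V k)" by blast
    qed
    moreover have "\<forall>i. bounded (V i)" using D(1) by (auto simp: V_def split: prod.splits)
    ultimately show ?case using 1 by blast
  qed
  show ?thesis unfolding hausdorff_null_def
  proof (intro allI impI)
    fix \<epsilon> :: real assume e: "\<epsilon> > 0"
    \<comment> \<open>\<open>C\<close> has no sign hypothesis and \<open>ennreal\<close> sends
      negative reals to 0, so the bound is passed to \<open>max C 0\<close>.\<close>
    have "(\<lambda>k. (1/2)^k * max C 0 :: real) \<longlonglongrightarrow> 0 * max C 0"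
      by (intro tendsto_mult LIMSEQ_realpow_zero tendsto_const) auto
    then have "eventually (\<lambda>k. (1/2)^k * max C 0 < \<epsilon>) sequentially"
      using e by (auto dest: order_tendstoD(2))
    then obtain k where k: "(1/2)^k * max C 0 < \<epsilon>" by (auto simp: eventually_sequentially)
    have "ennreal ((1/2)^k) * ennreal C \<le> ennreal ((1/2)^k) * ennreal (max C 0)"
      by (intro mult_left_mono ennreal_leI) auto
    also have "\<dots> \<le> ennreal \<epsilon>"
      using k by (simp add: ennreal_leI flip: ennreal_mult)
    finally show "\<exists>U::nat \<Rightarrow> real set. S \<subseteq> (\<Union>i. U i) \<and> (\<forall>i. bounded (U i)) \<and>
     (\<Sum>i. ennreal (diameter (U i) powr s)) \<le> ennreal \<epsilon>"
      using step[of k] by (meson order_trans)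
  qed
qed

text \<open>\<open>hausdorff_null\<close> puts no bound on the diameters in a cover; for s > 0 the
  cost supplies it, since a total cost of at most \<open>\<delta> powr s\<close> forces each single
  diameter to be at most \<delta>.\<close>

lemma hausdorff_measure_eq_0:
  assumes "s > 0" "hausdorff_null s A"
  shows "hausdorff_measure s A = 0"
proof -
  have "hausdorff_pre s \<delta> A = 0" if d: "\<delta> > 0" for \<delta>
  proof -
    have le: "hausdorff_pre s \<delta> A \<le> 0 + ennreal \<epsilon>" if e: "\<epsilon> > 0" for \<epsilon>
    proof -
      have "min \<epsilon> (\<delta> powr s) > 0" using e d by simp
      then obtain U :: "nat \<Rightarrow> real set" where U: "A \<subseteq> (\<Union>i. U i)" "\<And>i. bounded (U i)"
       "(\<Sum>i. ennreal (diameter (U i) powr s)) \<le> ennreal (min \<epsilon> (\<delta> powr s))"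
        using assms(2) unfolding hausdorff_null_def by blast
      have "diameter (U i) \<le> \<delta>" for i
      proof -
        have "ennreal (diameter (U i) powr s) \<le> (\<Sum>i. ennreal (diameter (U i) powr s))"
          by (rule order_trans[OF _ sum_le_suminf[of _ "{i}"]]) auto
        also have "\<dots> \<le> ennreal (\<delta> powr s)"
          by (rule order_trans[OF U(3)]) (intro ennreal_leI min.cobounded2)
        finally have "diameter (U i) powr s \<le> \<delta> powr s" by (subst (asm) ennreal_le_iff) auto
        then show ?thesis
          using powr_less_mono2[OF assms(1) less_imp_le[OF d], of "diameter (U i)"] by linarith
      qed
      then have "hausdorff_pre s \<delta> A \<le> (\<Sum>i. ennreal (diameter (U i) powr s))"
        unfolding hausdorff_pre_def using U by (intro INF_lower) auto
      also have "\<dots> \<le> ennreal \<epsilon>" by (rule order_trans[OF U(3)]) (intro ennreal_leI min.cobounded1)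
      finally show ?thesis by simp
    qed
    have "hausdorff_pre s \<delta> A \<le> 0" by (rule ennreal_le_epsilon) (rule le)
    then show ?thesis by simp
  qed
  then show ?thesis unfolding hausdorff_measure_def by (simp add: SUP_eq_const)
qed

lemma hausdorff_dim_eq_0:
  assumes "\<And>s. s > 0 \<Longrightarrow> hausdorff_null s A"
  shows "hausdorff_dim A = 0"
proof -
  have "{s. s > 0 \<and> hausdorff_measure s A = 0} = {0<..}"
    using assms hausdorff_measure_eq_0 by auto
  then show ?thesis unfolding hausdorff_dim_def by simp
qed

section \<open>Two-by-two matrices by entries\<close>

definition mk2 :: "real \<Rightarrow> real \<Rightarrow> real \<Rightarrow> real \<Rightarrow> mat2" where
  "mk2 a b c d = vector [vector [a, b], vector [c, d]]"

lemma mk2_nth [simp]: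
  "mk2 a b c d $ 1 $ 1 = a" "mk2 a b c d $ 1 $ 2 = b"
  "mk2 a b c d $ 2 $ 1 = c" "mk2 a b c d $ 2 $ 2 = d"
  by (simp_all add: mk2_def)

lemma mat2_eq_iff: "A = B \<longleftrightarrow> A$1$1 = B$1$1 \<and> A$1$2 = B$1$2 \<and> A$2$1 = B$2$1 \<and> A$2$2 = B$2$2"
  for A B :: mat2
  by (auto simp: vec_eq_iff forall_2)

lemma mat_1_nth2 [simp]:
  "(mat 1 :: mat2) $ 1 $ 1 = 1" "(mat 1 :: mat2) $ 1 $ 2 = 0"
  "(mat 1 :: mat2) $ 2 $ 1 = 0" "(mat 1 :: mat2) $ 2 $ 2 = 1"
  by (simp_all add: mat_def)

lemma mat2_mult_nth:
  fixes A B :: mat2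
  shows "(A ** B) $ i $ j = A$i$1 * B$1$j + A$i$2 * B$2$j"
  by (simp add: matrix_matrix_mult_def sum_2)

lemma matrix_inv_eqI:
  fixes A B :: mat2
  assumes "A ** B = mat 1"
  shows "matrix_inv A = B"
proof -
  have "B ** A = mat 1" using assms matrix_left_right_inverse by blast
  with assms have "\<exists>C. A ** C = mat 1 \<and> C ** A = mat 1" by blast
  then have "matrix_inv A ** A = mat 1" unfolding matrix_inv_def by (rule someI2_ex) blast
  then have "matrix_inv A ** A ** B = B" by simp
  then show ?thesis using assms by (simp add: matrix_mul_assoc[symmetric])
qed

section \<open>Moebius transformations\<close>

definition den :: "mat2 \<Rightarrow> complex \<Rightarrow> complex" where
  "den A z = of_real (A$2$1) * z + of_real (A$2$2)"

lemma act_diff: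
  assumes "det A = 1" "den A z \<noteq> 0" "den A w \<noteq> 0"
  shows "act A z - act A w = (z - w) / (den A z * den A w)"
proof -
  have d: "complex_of_real (A$1$1) * of_real (A$2$2) - of_real (A$1$2) * of_real (A$2$1) = 1"
    using arg_cong[OF assms(1), of complex_of_real] by (simp add: det_2)
  have "(of_real (A$1$1) * z + of_real (A$1$2)) * den A w - (of_real (A$1$1) * w + of_real (A$1$2)) * den A z
     = (of_real (A$1$1) * of_real (A$2$2) - of_real (A$1$2) * of_real (A$2$1)) * (z - w)"
    unfolding den_def by (simp add: algebra_simps)
  also have "\<dots> = z - w" unfolding d by simp
  finally show ?thesis
    using assms(2,3) unfolding act_def den_def[symmetric] by (simp add: diff_frac_eq)
qed

lemma den_uhp: "det A = 1 \<Longrightarrow> z \<in> uhp \<Longrightarrow> den A z \<noteq> 0"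
  by (auto simp: den_def uhp_def complex_eq_iff det_2)

lemma act_mult: "den B z \<noteq> 0 \<Longrightarrow> act (A ** B) z = act A (act B z)"
proof -
  assume a: "den B z \<noteq> 0"
  let ?n = "of_real (B$1$1) * z + of_real (B$1$2)"
  have "act A (act B z) = (of_real (A$1$1) * (?n / den B z) + of_real (A$1$2)) / (of_real (A$2$1) * (?n / den B z) + of_real (A$2$2))"
    by (simp add: act_def den_def)
  also have "\<dots> = ((of_real (A$1$1) * ?n + of_real (A$1$2) * den B z) / den B z) / ((of_real (A$2$1) * ?n + of_real (A$2$2) * den B z) / den B z)"
    using a by (simp only: add_divide_distrib times_divide_eq_right nonzero_mult_div_cancel_right)
       (simp add: field_simps)
  also have "\<dots> = (of_real (A$1$1) * ?n + of_real (A$1$2) * den B z) / (of_real (A$2$1) * ?n + of_real (A$2$2) * den B z)"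
    using a by simp
  also have "\<dots> = act (A ** B) z"
    by (simp add: act_def den_def mat2_mult_nth algebra_simps)
  finally show ?thesis by simp
qed

lemma act_mat1 [simp]: "act (mat 1) z = z"
  by (simp add: act_def)

lemma act_uminus [simp]: "act (- A) z = act A z"
proof -
  have "act (- A) z = - (of_real (A$1$1) * z + of_real (A$1$2)) / - (of_real (A$2$1) * z + of_real (A$2$2))"
    by (simp add: act_def)
  then show ?thesis by (simp add: act_def minus_divide_divide del: minus_add_distrib)
qed

text \<open>\<open>act_diff\<close> at \<open>z\<close> and \<open>cnj z\<close>: a real matrix
  commutes with conjugation, so both sides become multiples of the imaginary parts.\<close>

lemma Im_act:
  assumes "det A = 1" "z \<in> uhp"
  shows "Im (act A z) = Im z / (cmod (den A z))^2"
proof -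
  have "den A z \<noteq> 0" by (rule den_uhp[OF assms])
  have cn: "act A (cnj z) = cnj (act A z)" "den A (cnj z) = cnj (den A z)"
    by (simp_all add: act_def den_def)
  have "act A z - cnj (act A z) = (z - cnj z) / (den A z * cnj (den A z))"
    using act_diff[of A z "cnj z"] assms(1) \<open>den A z \<noteq> 0\<close> unfolding cn by simp
  then have "of_real (2 * Im (act A z)) * \<i> = of_real (2 * Im z / (cmod (den A z))^2) * \<i>"
    by (simp add: complex_diff_cnj complex_mult_cnj cmod_power2)
  then have "complex_of_real (2 * Im (act A z)) = of_real (2 * Im z / (cmod (den A z))^2)"
    by (rule mult_right_cancel[THEN iffD1, rotated]) simp
  then have "2 * Im (act A z) = 2 * Im z / (cmod (den A z))^2" by (simp only: of_real_eq_iff)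
  then show ?thesis by simp
qed

lemma act_uhp:
  assumes "det A = 1" "z \<in> uhp"
  shows "act A z \<in> uhp"
proof -
  have "den A z \<noteq> 0" by (rule den_uhp[OF assms])
  then show ?thesis
    unfolding uhp_def mem_Collect_eq Im_act[OF assms] using assms(2) by (simp add: uhp_def)
qed

lemma hdist_act:
  assumes A: "det A = 1" and z: "z \<in> uhp" and w: "w \<in> uhp"
  shows "hdist (act A z) (act A w) = hdist z w"
proof -
  have nz: "cmod (den A z) \<noteq> 0" "cmod (den A w) \<noteq> 0" using den_uhp[OF A] z w by auto
  have pos: "Im z > 0" "Im w > 0" using z w by (auto simp: uhp_def)
  have "(cmod (act A z - act A w))^2 / (2 * Im (act A z) * Im (act A w)) = (cmod (z - w))^2 / (2 * Im z * Im w)"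
    unfolding Im_act[OF A z] Im_act[OF A w] act_diff[OF A den_uhp[OF A z] den_uhp[OF A w]]
    using nz pos by (simp add: norm_divide norm_mult power_divide power_mult_distrib)
  then show ?thesis unfolding hdist_def by simp
qed

section \<open>The group\<close>

text \<open>With \<open>T\<close> the unit translation, \<open>gen j\<close> is \<open>T\<^bsup>2j\<^esup> [[1,0],[c,1]] T\<^bsup>2j\<^esup>\<close> where
  \<open>c = sgn j 2\<^bsup>|j|\<^esup>\<close>; its isometric circles are centred at \<open>cen (-j)\<close> and \<open>cen j\<close>.\<close>

definition gc :: "int \<Rightarrow> int" where "gc j = sgn j * 2 ^ nat \<bar>j\<bar>"
definition ga :: "int \<Rightarrow> int" where "ga j = gc j * (2 * j) + 1"
definition gb :: "int \<Rightarrow> int" where "gb j = gc j * (2 * j)^2 + 2 * (2 * j)"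
definition gen :: "int \<Rightarrow> mat2" where
  "gen j = mk2 (of_int (ga j)) (of_int (gb j)) (of_int (gc j)) (of_int (ga j))"
text \<open>For nonzero \<open>j\<close> this is a/c, the image of infinity under
  \<open>gen j\<close>; hence \<open>cen (- j)\<close> is the pole of \<open>gen j\<close>.\<close>

definition cen :: "int \<Rightarrow> real" where "cen j = 2 * of_int j + 1 / of_int (gc j)"
text \<open>The radius is the square of that of the isometric circle: this is the image under
  \<open>gen j\<close> of the outside of the unit disc about the pole \<open>cen (- j)\<close>,
  infinity included.\<close>

definition disc :: "int \<Rightarrow> complex set" where "disc j = cball (of_real (cen j)) (1 / (of_int (gc j))^2)"

lemma gc_minus [simp]: "gc (- j) = - gc j" by (simp add: gc_def)
lemma ga_minus [simp]: "ga (- j) = ga j" by (simp add: ga_def)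
lemma gb_minus [simp]: "gb (- j) = - gb j" by (simp add: gb_def)
lemma cen_minus [simp]: "cen (- j) = - cen j" by (simp add: cen_def)

lemma det_gen_int: "ga j * ga j - gb j * gc j = 1"
  by (simp add: ga_def gb_def algebra_simps power2_eq_square)

lemma det_gen [simp]: "det (gen j) = 1"
proof -
  have "real_of_int (ga j * ga j - gb j * gc j) = 1" by (simp only: det_gen_int of_int_1)
  then show ?thesis by (simp add: det_2 gen_def)
qed

text \<open>Equal diagonal entries and the oddness of \<open>gb\<close> and \<open>gc\<close> make
  \<open>gen (- j)\<close> the adjugate of \<open>gen j\<close>, so a letter is inverted by changing
  its sign. \<open>gen 0\<close> is the identity, hence the exclusion of the letter 0.\<close>

lemma gen_mult_gen_minus [simp]: "gen j ** gen (- j) = mat 1"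
proof -
  have "real_of_int (ga j * ga j - gb j * gc j) = 1" by (simp only: det_gen_int of_int_1)
  then show ?thesis by (simp add: mat2_eq_iff mat2_mult_nth gen_def algebra_simps)
qed

lemma abs_gc: "j \<noteq> 0 \<Longrightarrow> \<bar>real_of_int (gc j)\<bar> = 2 ^ nat \<bar>j\<bar>"
  by (simp add: gc_def abs_mult sgn_if)

lemma abs_gc_ge: 
  assumes "j \<noteq> 0" shows "\<bar>real_of_int (gc j)\<bar> \<ge> 2"
proof -
  have "(2::real)^1 \<le> 2 ^ nat \<bar>j\<bar>" using assms by (intro power_increasing) auto
  then show ?thesis using abs_gc[OF assms] by simp
qed

lemma gc_sq_ge:
  assumes "j \<noteq> 0" shows "(real_of_int (gc j))^2 \<ge> 4"
  using power_mono[OF abs_gc_ge[OF assms], of 2] by simp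

lemma gc_eq_0_iff [simp]: "gc j = 0 \<longleftrightarrow> j = 0"
  by (simp add: gc_def sgn_if)

text \<open>The correction \<open>1 / gc j\<close> has the sign of \<open>j\<close> and size at most
  1/2. For letters of equal sign it changes a distance of at least 2 by at most 1/2; for opposite
  signs it only pushes the centres apart.\<close>

lemma cen_dist:
  assumes "j \<noteq> 0" "k \<noteq> 0" "j \<noteq> k"
  shows "\<bar>cen j - cen k\<bar> \<ge> 3/2"
proof -
  have b: "\<bar>1 / real_of_int (gc i)\<bar> \<le> 1/2" if "i \<noteq> 0" for i
    using abs_gc_ge[OF that] by (simp add: abs_divide divide_simps)
  have p: "1 / real_of_int (gc i) > 0" if "i > 0" for i using that by (simp add: gc_def)
  have n: "1 / real_of_int (gc i) < 0" if "i < 0" for i using that by (simp add: gc_def)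
  have ij: "\<bar>real_of_int j - of_int k\<bar> \<ge> 1"
  proof -
    have "\<bar>j - k\<bar> \<ge> 1" using assms by simp
    then have "real_of_int \<bar>j - k\<bar> \<ge> of_int 1" by (simp only: of_int_le_iff)
    then show ?thesis by simp
  qed
  consider "j > 0" "k > 0" | "j < 0" "k < 0" | "j > 0" "k < 0" | "j < 0" "k > 0" using assms by linarith
  then show ?thesis
  proof cases
    case 1 then show ?thesis using p[of j] p[of k] b[of j] b[of k] ij unfolding cen_def by linarith
  next
    case 2 then show ?thesis using n[of j] n[of k] b[of j] b[of k] ij unfolding cen_def by linarith
  next
    case 3
    then have "real_of_int j \<ge> 1" "real_of_int k \<le> -1" by linarith+
    then show ?thesis using 3 p[of j] n[of k] unfolding cen_def by linarith
  next
    case 4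
    then have "real_of_int k \<ge> 1" "real_of_int j \<le> -1" by linarith+
    then show ?thesis using 4 p[of k] n[of j] unfolding cen_def by linarith
  qed
qed

lemma abs_cen_ge: assumes "j \<noteq> 0" shows "\<bar>cen j\<bar> \<ge> 3/2"
proof -
  have b: "\<bar>1 / real_of_int (gc j)\<bar> \<le> 1/2"
    using abs_gc_ge[OF assms] by (simp add: abs_divide divide_simps)
  have "\<bar>real_of_int j\<bar> \<ge> 1" using assms by linarith
  with b show ?thesis unfolding cen_def by linarith
qed

section \<open>How a generator moves the discs\<close>

lemma den_gen: "j \<noteq> 0 \<Longrightarrow> den (gen j) z = of_int (gc j) * (z - of_real (cen (- j)))"
  by (simp add: den_def gen_def cen_def ga_def algebra_simps)

lemma norm_den_gen: "j \<noteq> 0 \<Longrightarrow> cmod (den (gen j) z) = \<bar>of_int (gc j)\<bar> * cmod (z - of_real (cen (- j)))"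
  by (simp add: den_gen norm_mult)

text \<open>The general form a/c - 1/(c(cz + d)) of a unit determinant map, with a/c =
  \<open>cen j\<close> and pole \<open>cen (- j)\<close>. Ping-pong and \<open>escape\<close> read
  their distances off this formula.\<close>

lemma act_gen_diff_cen:
  assumes "j \<noteq> 0" "z \<noteq> of_real (cen (- j))"
  shows "act (gen j) z - of_real (cen j) = - 1 / ((of_int (gc j))^2 * (z - of_real (cen (- j))))"
proof -
  define c :: complex where "c = of_int (gc j)"
  define m :: complex where "m = of_int (2 * j)"
  have c: "c \<noteq> 0" using assms(1) by (simp add: c_def)
  define e where "e = z - of_real (cen (- j))"
  have e: "e \<noteq> 0" using assms(2) unfolding e_def right_minus_eq .
  have e_eq: "z = e - m - 1 / c" by (simp add: e_def cen_def c_def m_def)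
  have "act (gen j) z = ((c * m + 1) * z + (c * m^2 + 2 * m)) / (c * e)"
    using den_gen[OF assms(1), of z] unfolding act_def den_def
    by (simp add: gen_def ga_def gb_def c_def m_def e_def)
  moreover have "(c * m + 1) * z + (c * m^2 + 2 * m) = (c * m + 1) * e - 1 / c"
    unfolding e_eq using c by (simp add: field_simps power2_eq_square)
  ultimately have 1: "act (gen j) z = ((c * m + 1) * e - 1 / c) / (c * e)" by simp
  have 2: "complex_of_real (cen j) = m + 1 / c" by (simp add: cen_def c_def m_def)
  have "act (gen j) z - of_real (cen j) = - 1 / (c^2 * e)"
    unfolding 1 2 using c e by (simp add: field_simps power2_eq_square)
  then show ?thesis by (simp add: c_def e_def)
qed

lemma norm_act_gen_diff_cen:
  assumes "j \<noteq> 0" "z \<noteq> of_real (cen (- j))"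
  shows "cmod (act (gen j) z - of_real (cen j)) = 1 / ((of_int (gc j))^2 * cmod (z - of_real (cen (- j))))"
  unfolding act_gen_diff_cen[OF assms] by (simp add: norm_divide norm_mult norm_power)

lemma mem_disc: "z \<in> disc j \<longleftrightarrow> cmod (z - of_real (cen j)) \<le> 1 / (of_int (gc j))^2"
  by (simp add: disc_def dist_norm norm_minus_commute)

lemma act_gen_in_disc:
  assumes "j \<noteq> 0" "cmod (z - of_real (cen (- j))) \<ge> 1"
  shows "act (gen j) z \<in> disc j"
proof -
  have "z \<noteq> of_real (cen (- j))" using assms(2) by auto
  moreover have "1 / ((of_int (gc j))^2 * cmod (z - of_real (cen (- j)))) \<le> 1 / (of_int (gc j))^2"
  proof (rule divide_left_mono)
    show "(real_of_int (gc j))^2 \<le> (of_int (gc j))^2 * cmod (z - of_real (cen (- j)))"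
      using mult_left_mono[OF assms(2), of "(real_of_int (gc j))^2"] by simp
    show "0 < (real_of_int (gc j))^2 * cmod (z - of_real (cen (- j))) * (of_int (gc j))^2"
      using assms by (intro mult_pos_pos) auto
  qed simp
  ultimately show ?thesis unfolding mem_disc using norm_act_gen_diff_cen[OF assms(1), of z] by linarith
qed

lemma act_gen_disc_far:
  assumes "j \<noteq> 0" "z \<in> disc j" "z \<noteq> of_real (cen j)"
  shows "cmod (act (gen (- j)) z - of_real (cen (- j))) \<ge> 1"
proof -
  have g: "(real_of_int (gc j))^2 > 0" using gc_sq_ge[OF assms(1)] by linarith
  have "(of_int (gc j))^2 * cmod (z - of_real (cen j)) \<le> 1"
    using assms(2) g unfolding mem_disc by (simp add: field_simps)
  moreover have "(of_int (gc j))^2 * cmod (z - of_real (cen j)) > 0" using assms(3) g by simp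
  ultimately show ?thesis using norm_act_gen_diff_cen[of "- j" z] assms by simp
qed

text \<open>Centres are 3/2 apart and radii are at most 1/4. What matters is that 5/4 exceeds 1, the
  distance from the pole that \<open>act_gen_in_disc\<close> asks for.\<close>

lemma disc_far:
  assumes "j \<noteq> 0" "k \<noteq> 0" "j \<noteq> k" "z \<in> disc j"
  shows "cmod (z - of_real (cen k)) \<ge> 5/4"
proof -
  have "cmod (z - of_real (cen j)) \<le> 1/4"
    using assms(4) gc_sq_ge[OF assms(1)] unfolding mem_disc
    by (smt (verit) frac_le)
  moreover have "cmod (of_real (cen j) - of_real (cen k)) \<ge> 3/2"
    using cen_dist[OF assms(1-3)] by (simp flip: of_real_diff)
  moreover have "cmod (of_real (cen j) - of_real (cen k)) \<le> cmod (z - of_real (cen j)) + cmod (z - of_real (cen k))"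
    by (metis dist_norm dist_triangle2 norm_minus_commute)
  ultimately show ?thesis by linarith
qed

lemma ii_far: "j \<noteq> 0 \<Longrightarrow> cmod (\<i> - of_real (cen j)) \<ge> 5/4"
  using abs_cen_ge[of j] abs_Re_le_cmod[of "\<i> - of_real (cen j)"] by simp

lemma disc_radius_le: "j \<noteq> 0 \<Longrightarrow> 1 / (real_of_int (gc j))^2 \<le> 1/4"
  using gc_sq_ge[of j] by (simp add: divide_simps)

lemma ii_notin_disc: "j \<noteq> 0 \<Longrightarrow> \<i> \<notin> disc j"
  using ii_far[of j] disc_radius_le[of j] unfolding mem_disc by linarith

section \<open>Words in the generators and ping-pong\<close>

definition wprod :: "int list \<Rightarrow> mat2" where
  "wprod ws = foldr (\<lambda>j A. gen j ** A) ws (mat 1)"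

lemma wprod_simps [simp]: "wprod [] = mat 1" "wprod (j # ws) = gen j ** wprod ws"
  by (simp_all add: wprod_def)

lemma wprod_append: "wprod (us @ vs) = wprod us ** wprod vs"
  by (induction us) (simp_all add: matrix_mul_assoc)

lemma det_wprod [simp]: "det (wprod ws) = 1"
  by (induction ws) (simp_all add: det_mul)

lemma wprod_inverse: "wprod ws ** wprod (rev (map uminus ws)) = mat 1"
proof (induction ws)
  case (Cons j ws)
  have "wprod (j # ws) ** wprod (rev (map uminus (j # ws)))
      = gen j ** (wprod ws ** wprod (rev (map uminus ws))) ** gen (- j)"
    by (simp add: wprod_append matrix_mul_assoc)
  then show ?case by (simp add: Cons)
qed simp

text \<open>Both signs are included because the set is the full preimage of a subgroup of
  PSL(2,R).\<close>

definition wgroup :: "int set \<Rightarrow> mat2 set" where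
  "wgroup L = {A. \<exists>ws. set ws \<subseteq> L \<and> (A = wprod ws \<or> A = - wprod ws)}"

lemma matrix_mult_uminus_left: "(- A) ** B = - (A ** B)" for A B :: mat2
  by (simp add: mat2_eq_iff mat2_mult_nth)
lemma matrix_mult_uminus_right: "A ** (- B) = - (A ** B)" for A B :: mat2
  by (simp add: mat2_eq_iff mat2_mult_nth)

lemma det_uminus2: "det (- A) = det A" for A :: mat2
  by (simp add: det_2)

lemma wgroup_det: "A \<in> wgroup L \<Longrightarrow> det A = 1"
  by (auto simp: wgroup_def det_uminus2)

lemma wgroup_mono: "L \<subseteq> M \<Longrightarrow> wgroup L \<subseteq> wgroup M"
  unfolding wgroup_def by blast

lemma wgroup_mult: "A \<in> wgroup L \<Longrightarrow> B \<in> wgroup L \<Longrightarrow> A ** B \<in> wgroup L"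
proof -
  assume "A \<in> wgroup L" "B \<in> wgroup L"
  then obtain us vs where "set us \<subseteq> L" "A = wprod us \<or> A = - wprod us"
     "set vs \<subseteq> L" "B = wprod vs \<or> B = - wprod vs" unfolding wgroup_def by blast
  then show ?thesis unfolding wgroup_def
    by (intro CollectI exI[of _ "us @ vs"])
       (auto simp: wprod_append matrix_mult_uminus_left matrix_mult_uminus_right)
qed

lemma wgroup_inv: 
  assumes "uminus ` L \<subseteq> L" "A \<in> wgroup L"
  shows "matrix_inv A \<in> wgroup L"
proof -
  obtain us where us: "set us \<subseteq> L" "A = wprod us \<or> A = - wprod us" using assms(2) unfolding wgroup_def by blast
  let ?v = "rev (map uminus us)"
  have "set ?v \<subseteq> L" using us(1) assms(1) by auto
  moreover have "A ** wprod ?v = mat 1 \<or> A ** (- wprod ?v) = mat 1"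
    using us(2) wprod_inverse[of us] by (auto simp: matrix_mult_uminus_left matrix_mult_uminus_right)
  ultimately show ?thesis unfolding wgroup_def using matrix_inv_eqI by blast
qed

lemma wgroup_ids: "mat 1 \<in> wgroup L" "- mat 1 \<in> wgroup L"
  unfolding wgroup_def by (auto intro!: exI[of _ "[]"])

lemma gen_in_wgroup: "j \<in> L \<Longrightarrow> gen j \<in> wgroup L"
  unfolding wgroup_def by (auto intro!: exI[of _ "[j]"])

lemma wgroup_subgroup: "uminus ` L \<subseteq> L \<Longrightarrow> sl2_subgroup (wgroup L)"
  unfolding sl2_subgroup_def SL2_def
  by (simp add: wgroup_det wgroup_mult wgroup_inv wgroup_ids subset_iff)

text \<open>A letter put in front of a reduced word either extends it or cancels its head.\<close>

lemma reduced_word: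
  "\<exists>vs. set vs \<subseteq> set ws \<and> successively (\<lambda>i j. j \<noteq> - i) vs \<and> wprod vs = wprod ws"
proof (induction ws)
  case Nil then show ?case by (intro exI[of _ "[]"]) auto
next
  case (Cons j ws)
  then obtain vs where vs: "set vs \<subseteq> set ws" "successively (\<lambda>i j. j \<noteq> - i) vs" "wprod vs = wprod ws" by blast
  show ?case
  proof (cases "vs \<noteq> [] \<and> hd vs = - j")
    case True
    then obtain us where us: "vs = (- j) # us" by (metis list.collapse)
    have "wprod us = wprod (j # ws)"
      using us by (simp flip: vs(3)) (simp add: matrix_mul_assoc)
    moreover have "successively (\<lambda>i j. j \<noteq> - i) us" using vs(2) unfolding us by (cases us) auto
    ultimately show ?thesis using us vs(1) by (intro exI[of _ us]) auto
  next
    case False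
    then have "successively (\<lambda>i j. j \<noteq> - i) (j # vs)" using vs(2) by (cases vs) auto
    then show ?thesis using vs by (intro exI[of _ "j # vs"]) auto
  qed
qed

lemma ii_uhp: "\<i> \<in> uhp" by (simp add: uhp_def)

text \<open>The image under the rest of the word is \<i> or lies in the disc of a letter other than
  \<open>- j\<close>; either way it is at distance at least 1 from the pole of
  \<open>gen j\<close>.\<close>

lemma ping_pong:
  assumes "successively (\<lambda>i j. j \<noteq> - i) vs" "vs \<noteq> []" "0 \<notin> set vs"
  shows "act (wprod vs) \<i> \<in> disc (hd vs)"
  using assms
proof (induction vs)
  case (Cons j vs)
  have eq: "act (wprod (j # vs)) \<i> = act (gen j) (act (wprod vs) \<i>)"
    by (simp add: act_mult den_uhp ii_uhp)
  have j: "j \<noteq> 0" using Cons.prems by auto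
  have "cmod (act (wprod vs) \<i> - of_real (cen (- j))) \<ge> 1"
  proof (cases vs)
    case Nil then show ?thesis using ii_far[of "- j"] j by simp
  next
    case (Cons k us)
    then have "act (wprod vs) \<i> \<in> disc k" using Cons.IH Cons.prems by auto
    moreover have "k \<noteq> - j" "k \<noteq> 0" using Cons Cons.prems by auto
    ultimately show ?thesis using disc_far[of k "- j"] j by fastforce
  qed
  then show ?case unfolding eq using act_gen_in_disc[OF j] by simp
qed simp

lemma wgroup_orbit_ii:
  assumes "A \<in> wgroup L" "0 \<notin> L"
  shows "act A \<i> = \<i> \<or> (\<exists>j\<in>L. act A \<i> \<in> disc j)"
proof -
  obtain ws where ws: "set ws \<subseteq> L" "A = wprod ws \<or> A = - wprod ws" using assms(1) unfolding wgroup_def by blast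
  obtain vs where vs: "set vs \<subseteq> set ws" "successively (\<lambda>i j. j \<noteq> - i) vs" "wprod vs = wprod ws"
    using reduced_word by blast
  have eq: "act A \<i> = act (wprod vs) \<i>" using ws(2) vs(3) by auto
  show ?thesis
  proof (cases "vs = []")
    case True then show ?thesis unfolding eq by simp
  next
    case False
    then have "hd vs \<in> L" using hd_in_set vs(1) ws(1) by blast
    moreover have "act A \<i> \<in> disc (hd vs)" unfolding eq
      by (rule ping_pong) (use vs ws assms(2) False in auto)
    ultimately show ?thesis by blast
  qed
qed

definition \<Gamma> :: "mat2 set" where "\<Gamma> = wgroup (- {0})"

lemma gen_in_\<Gamma>: "j \<noteq> 0 \<Longrightarrow> gen j \<in> \<Gamma>"
  unfolding \<Gamma>_def by (rule gen_in_wgroup) simp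

lemma \<Gamma>_subgroup: "sl2_subgroup \<Gamma>"
  unfolding \<Gamma>_def by (rule wgroup_subgroup) auto

text \<open>Finitely many elements involve only letters up to some \<open>N\<close>, and the group
  on these letters keeps the orbit of \<i> in \<i> and their discs. The generator
  \<open>N + 1\<close> moves \<i> into its own disc, which misses all of these.\<close>

lemma not_finitely_generated_\<Gamma>: "\<not> finitely_generated \<Gamma>"
proof
  assume "finitely_generated \<Gamma>"
  then obtain S where S: "finite S" "\<Gamma> = sl2_generated S" unfolding finitely_generated_def by blast
  define L where "L N = {j::int. j \<noteq> 0 \<and> \<bar>j\<bar> \<le> int N}" for N
  have Lm: "L M \<subseteq> L N" if "M \<le> N" for M N using that by (auto simp: L_def)
  have "S \<subseteq> \<Gamma>" unfolding S(2) sl2_generated_def by blast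
  moreover have ex: "\<exists>N. A \<in> wgroup (L N)" if A: "A \<in> \<Gamma>" for A
  proof -
    obtain ws where ws: "set ws \<subseteq> - {0}" "A = wprod ws \<or> A = - wprod ws" using A unfolding \<Gamma>_def wgroup_def by blast
    have "j \<in> L (\<Sum>i\<leftarrow>ws. nat \<bar>i\<bar>)" if "j \<in> set ws" for j
    proof -
      have "nat \<bar>j\<bar> \<le> (\<Sum>i\<leftarrow>ws. nat \<bar>i\<bar>)" using that by (intro member_le_sum_list) auto
      then show ?thesis using that ws(1) by (auto simp: L_def)
    qed
    then show ?thesis using ws(2) unfolding wgroup_def by blast
  qed
  ultimately have "\<forall>A\<in>S. \<exists>N. A \<in> wgroup (L N)" by blast
  then obtain f where f: "\<And>A. A \<in> S \<Longrightarrow> A \<in> wgroup (L (f A))" by metis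
  define N where "N = sum f S"
  have "S \<subseteq> wgroup (L N)"
  proof
    fix A assume A: "A \<in> S"
    then have "f A \<le> N" unfolding N_def using S(1) by (intro member_le_sum) auto
    then show "A \<in> wgroup (L N)" using f[OF A] wgroup_mono[OF Lm] by blast
  qed
  moreover have "sl2_subgroup (wgroup (L N))" by (rule wgroup_subgroup) (auto simp: L_def)
  ultimately have sub: "\<Gamma> \<subseteq> wgroup (L N)" unfolding S(2) sl2_generated_def by blast
  define k where "k = int N + 1"
  have k: "k \<noteq> 0" by (simp add: k_def)
  have "gen k \<in> wgroup (L N)" using sub gen_in_\<Gamma>[OF k] by blast
  then have "act (gen k) \<i> = \<i> \<or> (\<exists>j\<in>L N. act (gen k) \<i> \<in> disc j)"
    by (rule wgroup_orbit_ii) (simp add: L_def)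
  moreover have kd: "act (gen k) \<i> \<in> disc k"
    by (rule act_gen_in_disc[OF k]) (use ii_far[of "- k"] k in auto)
  ultimately obtain j where j: "j \<in> L N" "act (gen k) \<i> \<in> disc j" using ii_notin_disc[OF k] by auto
  then have "j \<noteq> 0" "j \<noteq> k" by (auto simp: L_def k_def)
  then have "cmod (act (gen k) \<i> - of_real (cen k)) \<ge> 5/4" using disc_far[OF _ k _ j(2)] by blast
  then show False using kd disc_radius_le[OF k] unfolding mem_disc by linarith
qed

section \<open>Discreteness and torsion\<close>

definition principal2 :: "mat2 set" where
  "principal2 = {A. \<exists>a b c d::int. A = mk2 (of_int a) (of_int b) (of_int c) (of_int d) \<and>
     a * d - b * c = 1 \<and> odd a \<and> odd d \<and> even b \<and> even c}"

lemma gen_principal2: "gen j \<in> principal2"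
proof -
  have "even (gc j)" by (cases "j = 0") (auto simp: gc_def)
  then have "odd (ga j)" "even (gb j)" by (auto simp: ga_def gb_def)
  then show ?thesis unfolding principal2_def gen_def using \<open>even (gc j)\<close> det_gen_int[of j] by blast
qed

lemma principal2_mult:
  assumes "A \<in> principal2" "B \<in> principal2"
  shows "A ** B \<in> principal2"
proof -
  obtain a b c d where A: "A = mk2 (of_int a) (of_int b) (of_int c) (of_int d)"
    "a * d - b * c = 1" "odd a" "odd d" "even b" "even c" using assms(1) unfolding principal2_def by blast
  obtain a' b' c' d' where B: "B = mk2 (of_int a') (of_int b') (of_int c') (of_int d')"
    "a' * d' - b' * c' = 1" "odd a'" "odd d'" "even b'" "even c'" using assms(2) unfolding principal2_def by blast
  have "A ** B = mk2 (of_int (a*a'+b*c')) (of_int (a*b'+b*d')) (of_int (c*a'+d*c')) (of_int (c*b'+d*d'))"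
    by (simp add: A(1) B(1) mat2_eq_iff mat2_mult_nth)
  moreover have "(a*a'+b*c') * (c*b'+d*d') - (a*b'+b*d') * (c*a'+d*c') = (a*d-b*c) * (a'*d'-b'*c')"
    by algebra
  ultimately show ?thesis unfolding principal2_def using A(2-) B(2-)
    by (intro CollectI exI[of _ "a*a'+b*c'"] exI[of _ "a*b'+b*d'"] exI[of _ "c*a'+d*c'"] exI[of _ "c*b'+d*d'"]) simp
qed

lemma \<Gamma>_principal2: "\<Gamma> \<subseteq> principal2"
proof
  fix A assume "A \<in> \<Gamma>"
  then obtain ws where ws: "A = wprod ws \<or> A = - wprod ws" unfolding \<Gamma>_def wgroup_def by blast
  have one: "mat 1 \<in> principal2" unfolding principal2_def
    by (intro CollectI exI[of _ 1] exI[of _ 0]) (simp add: mat2_eq_iff)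
  have mone: "- mat 1 \<in> principal2" unfolding principal2_def
    by (intro CollectI, rule exI[of _ "-1"], rule exI[of _ 0], rule exI[of _ 0], rule exI[of _ "-1"])
       (simp add: mat2_eq_iff)
  have w: "wprod ws \<in> principal2" by (induction ws) (auto simp: one gen_principal2 principal2_mult)
  moreover have "- wprod ws = (- mat 1) ** wprod ws" by (simp add: matrix_mult_uminus_left)
  ultimately show "A \<in> principal2" using ws principal2_mult[OF mone w] by auto
qed

lemma norm_entry_le: "\<bar>A $ i $ j\<bar> \<le> norm A" for A :: mat2
  using Finite_Cartesian_Product.norm_nth_le[of "A $ i" j] Finite_Cartesian_Product.norm_nth_le[of A i] by simp

text \<open>The entries are integers, so an element other than the identity differs from it by at
  least 1 in some entry.\<close>

lemma fuchsian_\<Gamma>: "fuchsian \<Gamma>"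
proof -
  have "norm (A - mat 1) \<ge> 1" if A\<Gamma>: "A \<in> \<Gamma>" and ne: "A \<noteq> mat 1" for A
  proof -
    obtain a b c d :: int where A: "A = mk2 (of_int a) (of_int b) (of_int c) (of_int d)"
      using subsetD[OF \<Gamma>_principal2 A\<Gamma>] unfolding principal2_def by blast
    have "a \<noteq> 1 \<or> b \<noteq> 0 \<or> c \<noteq> 0 \<or> d \<noteq> 1" using ne A by (auto simp: mat2_eq_iff)
    then have "\<bar>of_int a - 1\<bar> \<ge> (1::real) \<or> \<bar>of_int b\<bar> \<ge> (1::real) \<or> \<bar>of_int c\<bar> \<ge> (1::real) \<or> \<bar>of_int d - 1\<bar> \<ge> (1::real)"
      by linarith
    then show ?thesis
      using norm_entry_le[of "A - mat 1" 1 1] norm_entry_le[of "A - mat 1" 1 2]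
        norm_entry_le[of "A - mat 1" 2 1] norm_entry_le[of "A - mat 1" 2 2] by (auto simp: A)
  qed
  then show ?thesis unfolding fuchsian_def psl2_subgroup_def
    using \<Gamma>_subgroup wgroup_ids(2) by (auto simp: \<Gamma>_def intro!: exI[of _ 1])
qed

text \<open>Elements of the level-2 congruence subgroup have trace congruent to 2 modulo 4, hence are never elliptic.\<close>
lemma principal2_trace:
  assumes "A \<in> principal2" shows "\<bar>A$1$1 + A$2$2\<bar> \<ge> 2"
proof -
  obtain a b c d where A: "A = mk2 (of_int a) (of_int b) (of_int c) (of_int d)"
    "a * d - b * c = 1" "odd a" "odd d" "even b" "even c" using assms(1) unfolding principal2_def by blast
  obtain a' where a: "a = 2*a'+1" using A by (auto elim: oddE)
  obtain d' where d: "d = 2*d'+1" using A by (auto elim: oddE)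
  obtain b' where b: "b = 2*b'" using A by (auto elim: evenE)
  obtain c' where c: "c = 2*c'" using A by (auto elim: evenE)
  have "a' + d' = 2 * (b' * c' - a' * d')" using A(2) unfolding a b c d by (simp add: algebra_simps)
  then have "\<bar>a + d\<bar> \<ge> 2" unfolding a d by presburger
  then have "\<bar>real_of_int a + of_int d\<bar> \<ge> 2" by linarith
  then show ?thesis by (simp add: A(1))
qed

text \<open>By Cayley--Hamilton the powers are \<open>p\<^sub>n A - p\<^sub>n\<^sub>-\<^sub>1 I\<close>, with \<open>|p\<^sub>n|\<close> strictly increasing as \<open>|tr A| \<ge> 2\<close>.\<close>
lemma mpow_cayley_hamilton:
  fixes A :: mat2
  assumes "det A = 1" "\<bar>A$1$1 + A$2$2\<bar> \<ge> 2"
  shows "\<exists>p q::real. \<bar>p\<bar> \<ge> \<bar>q\<bar> + 1 \<and> mpow A (Suc n) = p *\<^sub>R A - q *\<^sub>R mat 1"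
proof (induction n)
  case 0 then show ?case by (intro exI[of _ 1] exI[of _ 0]) simp
next
  case (Suc n)
  then obtain p q where pq: "\<bar>p\<bar> \<ge> \<bar>q\<bar> + 1" "mpow A (Suc n) = p *\<^sub>R A - q *\<^sub>R mat 1" by blast
  let ?t = "A$1$1 + A$2$2"
  have d: "A$1$2 * A$2$1 = A$1$1 * A$2$2 - 1" using assms(1) by (simp add: det_2)
  have d': "A$2$1 * A$1$2 = A$1$1 * A$2$2 - 1" using d by (simp add: mult.commute)
  have "mpow A (Suc (Suc n)) = A ** (p *\<^sub>R A - q *\<^sub>R mat 1)" using pq(2) by simp
  also have "\<dots> = (?t * p - q) *\<^sub>R A - p *\<^sub>R mat 1"
    using d d' by (simp add: mat2_eq_iff mat2_mult_nth) (simp add: algebra_simps, algebra)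
  finally have "mpow A (Suc (Suc n)) = (?t * p - q) *\<^sub>R A - p *\<^sub>R mat 1" .
  moreover have "\<bar>?t * p - q\<bar> \<ge> \<bar>p\<bar> + 1"
  proof -
    have "\<bar>?t * p\<bar> \<ge> 2 * \<bar>p\<bar>" unfolding abs_mult using assms(2) by (intro mult_right_mono) auto
    then show ?thesis using pq(1) by linarith
  qed
  ultimately show ?case by blast
qed

text \<open>If \<open>p *\<^sub>R A - q *\<^sub>R mat 1\<close> is scalar, then
  \<open>p \<noteq> 0\<close> makes \<open>A\<close> scalar, and determinant 1 leaves the two
  signs.\<close>

lemma torsion_free_\<Gamma>: "torsion_free \<Gamma>"
  unfolding torsion_free_def
proof (intro ballI allI impI)
  fix A and n :: nat assume A: "A \<in> \<Gamma>" and n: "n > 0" and m: "mpow A n \<in> {mat 1, - mat 1}"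
  have det: "det A = 1" using A wgroup_det by (auto simp: \<Gamma>_def)
  obtain k where k: "n = Suc k" using n by (cases n) auto
  obtain p q :: real where pq: "\<bar>p\<bar> \<ge> \<bar>q\<bar> + 1" "mpow A n = p *\<^sub>R A - q *\<^sub>R mat 1"
    using mpow_cayley_hamilton[OF det principal2_trace] A \<Gamma>_principal2 unfolding k by blast
  have p: "p \<noteq> 0" using pq(1) by auto
  obtain e :: real where e: "p *\<^sub>R A - q *\<^sub>R mat 1 = e *\<^sub>R mat 1"
    using m unfolding pq(2) by (metis insertE scaleR_minus1_left scaleR_one singletonD)
  have "A$1$2 = 0" "A$2$1 = 0" "A$1$1 = A$2$2"
    using e p unfolding mat2_eq_iff by (auto simp: algebra_simps) (metis mult_left_cancel)
  moreover from this have "A$1$1 = 1 \<or> A$1$1 = -1" using det by (simp add: det_2 square_eq_1_iff)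
  ultimately show "A \<in> {mat 1, - mat 1}" by (auto simp: mat2_eq_iff)
qed

section \<open>The action on the real line\<close>

definition fr :: "int \<Rightarrow> real \<Rightarrow> real" where
  "fr j x = (of_int (ga j) * x + of_int (gb j)) / (of_int (gc j) * x + of_int (ga j))"

lemma of_real_fr: "complex_of_real (fr j x) = act (gen j) (of_real x)"
  by (simp add: fr_def act_def gen_def)

lemma norm_of_real_diff: "cmod (of_real x - of_real y) = \<bar>x - y\<bar>"
  by (metis norm_of_real of_real_diff)

lemma of_real_mem_disc: "of_real x \<in> disc j \<longleftrightarrow> \<bar>x - cen j\<bar> \<le> 1 / (of_int (gc j))^2"
  unfolding mem_disc norm_of_real_diff ..

lemma inverse_gc_sq: "j \<noteq> 0 \<Longrightarrow> 1 / (real_of_int (gc j))^2 = (1/4) ^ nat \<bar>j\<bar>"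
proof -
  assume j: "j \<noteq> 0"
  have "(real_of_int (gc j))^2 = (2 ^ nat \<bar>j\<bar>)^2" using abs_gc[OF j] by (metis power2_abs)
  also have "\<dots> = 4 ^ nat \<bar>j\<bar>" by (simp add: power2_eq_square flip: power_mult_distrib)
  finally show ?thesis by (simp add: power_one_over)
qed

text \<open>\<open>act_diff\<close> divides the distance by two denominators, each |c| times a
  distance of at least 1 from the pole, and 1/c^2 is 4^(-|j|).\<close>

lemma fr_Lipschitz:
  assumes j: "j \<noteq> 0" and x: "\<bar>x - cen (- j)\<bar> \<ge> 1" and y: "\<bar>y - cen (- j)\<bar> \<ge> 1"
  shows "\<bar>fr j x - fr j y\<bar> \<le> (1/4) ^ nat \<bar>j\<bar> * \<bar>x - y\<bar>"
proof -
  let ?c = "\<bar>real_of_int (gc j)\<bar>"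
  have c: "?c > 0" using j by simp
  have dn: "cmod (den (gen j) (of_real u)) = ?c * \<bar>u - cen (- j)\<bar>" for u
    unfolding norm_den_gen[OF j] norm_of_real_diff ..
  have dx: "cmod (den (gen j) (of_real x)) \<ge> ?c" and dy: "cmod (den (gen j) (of_real y)) \<ge> ?c"
    unfolding dn using mult_left_mono[OF x, of ?c] mult_left_mono[OF y, of ?c] by auto
  then have nz: "den (gen j) (of_real x) \<noteq> 0" "den (gen j) (of_real y) \<noteq> 0" using c by auto
  have "\<bar>fr j x - fr j y\<bar> = cmod (act (gen j) (of_real x) - act (gen j) (of_real y))"
    by (simp only: of_real_fr[symmetric] norm_of_real_diff)
  also have "\<dots> = \<bar>x - y\<bar> / (cmod (den (gen j) (of_real x)) * cmod (den (gen j) (of_real y)))"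
    unfolding act_diff[OF det_gen nz] norm_divide norm_mult norm_of_real_diff ..
  also have "\<dots> \<le> \<bar>x - y\<bar> / (?c * ?c)"
    using dx dy c by (intro divide_left_mono mult_mono mult_pos_pos) auto
  also have "\<dots> = (1/4) ^ nat \<bar>j\<bar> * \<bar>x - y\<bar>"
    unfolding inverse_gc_sq[OF j, symmetric] by (simp add: power2_eq_square)
  finally show ?thesis .
qed

lemma fr_inverse:
  assumes "j \<noteq> 0" "x \<noteq> cen j" shows "fr j (fr (- j) x) = x"
proof -
  have "den (gen (- j)) (of_real x) \<noteq> 0"
    using den_gen[of "- j" "of_real x"] assms by simp
  then have "act (gen j) (act (gen (- j)) (of_real x)) = of_real x"
    using act_mult[of "gen (- j)" "of_real x" "gen j"] by simp
  then have "complex_of_real (fr j (fr (- j) x)) = of_real x" by (simp add: of_real_fr)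
  then show ?thesis by (simp only: of_real_eq_iff)
qed

section \<open>Itineraries\<close>

text \<open>The orbit of \<open>x\<close> under the expanding map that undoes one letter,
  \<open>fr (- j)\<close> on \<open>disc j\<close>. Centres are excluded because their true image is
  infinity, where \<open>fr\<close> would return 0 by division by zero.\<close>

definition itinerary :: "real \<Rightarrow> (nat \<Rightarrow> int) \<Rightarrow> (nat \<Rightarrow> real) \<Rightarrow> bool" where
  "itinerary x l y \<longleftrightarrow> y 0 = x \<and> (\<forall>k. l k \<noteq> 0 \<and> of_real (y k) \<in> disc (l k) \<and> y k \<noteq> cen (l k) \<and>
     y (Suc k) = fr (- l k) (y k))"

lemma fr_disc_far:
  assumes "j \<noteq> 0" "of_real x \<in> disc j" "x \<noteq> cen j"
  shows "\<bar>fr (- j) x - cen (- j)\<bar> \<ge> 1"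
  using act_gen_disc_far[OF assms(1,2)] assms(3)
  unfolding of_real_fr[symmetric] norm_of_real_diff by simp

lemma itineraryD:
  assumes "itinerary x l y"
  shows "y 0 = x" "l k \<noteq> 0" "of_real (y k) \<in> disc (l k)" "y k \<noteq> cen (l k)"
    "y (Suc k) = fr (- l k) (y k)" "\<bar>y (Suc k) - cen (- l k)\<bar> \<ge> 1"
    "y k = fr (l k) (y (Suc k))"
proof -
  show *: "y 0 = x" "l k \<noteq> 0" "of_real (y k) \<in> disc (l k)" "y k \<noteq> cen (l k)"
    "y (Suc k) = fr (- l k) (y k)" using assms unfolding itinerary_def by blast+
  show "\<bar>y (Suc k) - cen (- l k)\<bar> \<ge> 1" unfolding *(5) by (rule fr_disc_far[OF *(2-4)])
  show "y k = fr (l k) (y (Suc k))" unfolding *(5) by (rule fr_inverse[OF *(2,4), symmetric])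
qed

lemma itinerary_shift:
  "itinerary x l y \<Longrightarrow> itinerary (y n) (\<lambda>k. l (k + n)) (\<lambda>k. y (k + n))"
  unfolding itinerary_def add_Suc add_0 by blast

lemma itinerary_next_ne:
  assumes "itinerary x l y" shows "l (Suc k) \<noteq> - l k"
proof
  assume e: "l (Suc k) = - l k"
  have "\<bar>y (Suc k) - cen (- l k)\<bar> \<le> 1/4"
    using itineraryD(3)[OF assms, of "Suc k"] disc_radius_le[OF itineraryD(2)[OF assms], of "Suc k"]
    unfolding e of_real_mem_disc by linarith
  moreover have "\<bar>y (Suc k) - cen (- l k)\<bar> \<ge> 1"
    by (rule itineraryD(6)[OF assms])
  ultimately show False by simp
qed

definition tails :: "nat \<Rightarrow> real set" where
  "tails N = {x. \<exists>l y. itinerary x l y \<and> (\<forall>k. int N \<le> \<bar>l k\<bar>)}"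

lemma abs_int_decode: "\<bar>int_decode i\<bar> \<le> int i" "int i \<le> 2 * \<bar>int_decode i\<bar>"
  unfolding int_decode_def sum_decode_def by (auto elim!: evenE oddE)

text \<open>Dropping the first letter stays inside \<open>tails N\<close>, so the set is covered by
  its own images under the letters of absolute value at least \<open>N\<close>. \<open>N\<close> is
  taken so large that the s-th powers of the contraction ratios sum to at most 1/2, as
  \<open>hausdorff_null_self_cover\<close> requires.\<close>

lemma tails_null:
  assumes s: "s > 0"
  shows "\<exists>N. hausdorff_null s (tails N)"
proof -
  define q :: real where "q = (1/2) powr s"
  have q: "0 < q" "q < 1" using s powr_less_mono2[of s "1/2" 1] by (auto simp: q_def)
  have pw: "((1/2)^i) powr s = q ^ i" for i
    by (simp add: q_def powr_powr powr_realpow[symmetric] mult.commute)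
  have "(\<lambda>n. q ^ n / (1 - q)) \<longlonglongrightarrow> 0 / (1 - q)"
    using q by (intro tendsto_divide LIMSEQ_realpow_zero tendsto_const) auto
  then have "eventually (\<lambda>n. q ^ n / (1 - q) < 1/2) sequentially"
    by (auto dest: order_tendstoD(2)[where a="1/2"])
  then obtain M where M: "\<And>n. n \<ge> M \<Longrightarrow> q ^ n / (1 - q) < 1/2" by (auto simp: eventually_sequentially)
  \<comment> \<open>The successor makes \<open>N\<close> positive, so that the enumeration
    \<open>J\<close> never meets the letter 0.\<close>
  define N where "N = Suc M"
  have N: "q ^ N / (1 - q) < 1/2" "N \<ge> 1" using M[of N] by (auto simp: N_def)
  \<comment> \<open>Positive and negative letters alternate, so |J i| is at least (i + N)/2 and the
    ratio 4^(-|J i|) is at most 2^(-(i + N)). Every letter of absolute value at least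
    \<open>N\<close> occurs, because its code is at least its absolute value.\<close>
  define J where "J i = int_decode (i + N)" for i
  have J0: "J i \<noteq> 0" for i
    using abs_int_decode(2)[of "i + N"] N(2) unfolding J_def by auto
  have small: "(1/4) ^ nat \<bar>J i\<bar> \<le> (1/2::real) ^ (i + N)" for i
  proof -
    have "(1/4::real) ^ nat \<bar>J i\<bar> = (1/2) ^ (2 * nat \<bar>J i\<bar>)" by (simp add: power_mult power2_eq_square)
    also have "\<dots> \<le> (1/2) ^ (i + N)"
      using abs_int_decode(2)[of "i + N"] unfolding J_def by (intro power_decreasing) auto
    finally show ?thesis .
  qed
  have sm: "(\<lambda>i. q ^ (i + N)) sums (q ^ N / (1 - q))"
    using sums_mult[OF geometric_sums[of q], of "q ^ N"] q by (simp add: power_add mult.commute)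
  have sum1: "(\<Sum>i. ennreal (((1/2) ^ (i + N)) powr s)) = ennreal (q ^ N / (1 - q))"
    unfolding pw by (rule suminf_ennreal_eq[OF _ sm]) (use q in auto)
  have idx: "\<exists>i. j = J i" if "int N \<le> \<bar>j\<bar>" for j
  proof -
    have "N \<le> int_encode j" using abs_int_decode(1)[of "int_encode j"] that by simp
    then have "j = J (int_encode j - N)" by (simp add: J_def)
    then show ?thesis by blast
  qed
  \<comment> \<open>The initial cover by one interval per first letter; its diameters are at most
    twice the ratios, hence the cost \<open>2 powr s / 2\<close>.\<close>
  define U0 where "U0 i = cball (cen (J i)) ((1/2) ^ (i + N))" for i
  have dU: "diameter (U0 i) \<le> 2 * (1/2) ^ (i + N)" for i
    unfolding U0_def by (rule diameter_le) (auto simp: dist_real_def abs_le_iff)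
  have "hausdorff_null s (tails N)"
  proof (rule hausdorff_null_self_cover[where \<rho> = "\<lambda>i. (1/2) ^ (i + N)" and f = "\<lambda>i. fr (J i)"
        and F = "\<lambda>i. {x. \<bar>x - cen (- J i)\<bar> \<ge> 1}" and ?U0.0 = U0 and C = "2 powr s / 2"])
    show "(\<Sum>i. ennreal (((1/2) ^ (i + N)) powr s)) \<le> ennreal (1/2)"
      unfolding sum1 using N(1) by (intro ennreal_leI) simp
    fix i x y
    assume "x \<in> {x. \<bar>x - cen (- J i)\<bar> \<ge> 1}" "y \<in> {x. \<bar>x - cen (- J i)\<bar> \<ge> 1}"
    then have "\<bar>fr (J i) x - fr (J i) y\<bar> \<le> (1/4) ^ nat \<bar>J i\<bar> * \<bar>x - y\<bar>"
      using fr_Lipschitz[OF J0] by blast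
    also have "\<dots> \<le> (1/2) ^ (i + N) * \<bar>x - y\<bar>" using small by (intro mult_right_mono) auto
    finally show "\<bar>fr (J i) x - fr (J i) y\<bar> \<le> (1/2) ^ (i + N) * \<bar>x - y\<bar>" .
  next
    show "tails N \<subseteq> (\<Union>i. fr (J i) ` (tails N \<inter> {x. \<bar>x - cen (- J i)\<bar> \<ge> 1}))"
    proof
      fix x assume "x \<in> tails N"
      then obtain l y where ly: "itinerary x l y" "\<And>k. int N \<le> \<bar>l k\<bar>" unfolding tails_def by blast
      have "y 1 \<in> tails N" unfolding tails_def using itinerary_shift[OF ly(1)] ly(2) by blast
      moreover obtain i where i: "l 0 = J i" using idx[OF ly(2)] by blast
      moreover have "\<bar>y 1 - cen (- J i)\<bar> \<ge> 1" "x = fr (J i) (y 1)"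
        using itineraryD(6,7)[OF ly(1), of 0] itineraryD(1)[OF ly(1)] unfolding i by auto
      ultimately show "x \<in> (\<Union>i. fr (J i) ` (tails N \<inter> {x. \<bar>x - cen (- J i)\<bar> \<ge> 1}))" by blast
    qed
    show "tails N \<subseteq> (\<Union>i. U0 i)"
    proof
      fix x assume "x \<in> tails N"
      then obtain l y where ly: "itinerary x l y" "\<And>k. int N \<le> \<bar>l k\<bar>" unfolding tails_def by blast
      obtain i where i: "l 0 = J i" using idx[OF ly(2)] by blast
      have "\<bar>x - cen (J i)\<bar> \<le> (1/4) ^ nat \<bar>J i\<bar>"
        using itineraryD(3)[OF ly(1), of 0] unfolding of_real_mem_disc i inverse_gc_sq[OF J0] itineraryD(1)[OF ly(1)] .
      with small[of i] have "x \<in> U0 i" by (simp add: U0_def dist_real_def abs_minus_commute)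
      then show "x \<in> (\<Union>i. U0 i)" by blast
    qed
    have "(\<Sum>i. ennreal (diameter (U0 i) powr s)) \<le> (\<Sum>i. ennreal (2 powr s) * ennreal (((1/2) ^ (i + N)) powr s))"
    proof (intro suminf_le)
      fix i
      have "diameter (U0 i) powr s \<le> (2 * (1/2) ^ (i + N)) powr s"
        using dU[of i] s by (intro powr_mono2 diameter_ge_0) (auto simp: U0_def)
      also have "\<dots> = 2 powr s * ((1/2) ^ (i + N)) powr s" by (simp add: powr_mult)
      finally show "ennreal (diameter (U0 i) powr s) \<le> ennreal (2 powr s) * ennreal (((1/2) ^ (i + N)) powr s)"
        by (subst ennreal_mult[symmetric]) (auto intro: ennreal_leI)
    qed auto
    also have "\<dots> = ennreal (2 powr s) * ennreal (q ^ N / (1 - q))" unfolding ennreal_suminf_cmult sum1 ..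
    also have "\<dots> \<le> ennreal (2 powr s) * ennreal (1/2)"
      using N(1) by (intro mult_left_mono ennreal_leI) auto
    also have "\<dots> = ennreal (2 powr s / 2)" by (subst ennreal_mult[symmetric]) auto
    finally show "(\<Sum>i. ennreal (diameter (U0 i) powr s)) \<le> ennreal (2 powr s / 2)" .
    show "bounded (U0 i)" for i by (simp add: U0_def)
  qed (use s in auto)
  then show ?thesis ..
qed

text \<open>Undoes one step of an itinerary. The restriction to points at distance at least 1 from
  the pole is what makes each branch Lipschitz; by \<open>fr_disc_far\<close> itineraries satisfy
  it.\<close>

definition prepend :: "real set \<Rightarrow> real set" where
  "prepend A = (\<Union>j\<in>-{0}. fr j ` (A \<inter> {x. \<bar>x - cen (- j)\<bar> \<ge> 1}))"

lemma prepend_null: "s > 0 \<Longrightarrow> hausdorff_null s A \<Longrightarrow> hausdorff_null s (prepend A)"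
  unfolding prepend_def
  by (intro hausdorff_null_UN_countable hausdorff_null_Lipschitz_image[where \<rho> = "(1/4) ^ nat \<bar>j\<bar>" for j])
     (auto intro: fr_Lipschitz)

lemma prepend_funpow_null: "s > 0 \<Longrightarrow> hausdorff_null s A \<Longrightarrow> hausdorff_null s ((prepend ^^ k) A)"
  by (induction k) (simp_all add: prepend_null)

lemma mem_prepend_funpow:
  assumes "\<And>i. i < k \<Longrightarrow> l i \<noteq> 0 \<and> of_real (y i) \<in> disc (l i) \<and> y i \<noteq> cen (l i) \<and> y (Suc i) = fr (- l i) (y i)"
    and "y k \<in> A"
  shows "y 0 \<in> (prepend ^^ k) A"
  using assms
proof (induction k arbitrary: y l)
  case (Suc k)
  have "y (Suc 0) \<in> (prepend ^^ k) A"
  proof (rule Suc.IH[of "\<lambda>i. l (Suc i)" "\<lambda>i. y (Suc i)"])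
    fix i assume "i < k"
    then show "l (Suc i) \<noteq> 0 \<and> of_real (y (Suc i)) \<in> disc (l (Suc i)) \<and> y (Suc i) \<noteq> cen (l (Suc i)) \<and>
        y (Suc (Suc i)) = fr (- l (Suc i)) (y (Suc i))"
      using Suc.prems(1)[of "Suc i"] by blast
  qed (rule Suc.prems(2))
  moreover have "l 0 \<noteq> 0" "\<bar>y (Suc 0) - cen (- l 0)\<bar> \<ge> 1" "y 0 = fr (l 0) (y (Suc 0))"
    using Suc.prems(1)[of 0] fr_disc_far[of "l 0" "y 0"] fr_inverse[of "l 0" "y 0"] by auto
  ultimately show ?case unfolding funpow.simps o_def prepend_def by blast
qed simp

section \<open>The limit set\<close>

text \<open>\<open>act A \<i>\<close> and \<open>act A x0\<close> differ by at most a constant times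
  the height of the latter, so along a sequence converging to a real point both orbits have the same
  limit. Distinct discs are at least 1 apart, so the orbit of \<i> ends up in a single closed
  disc.\<close>

lemma limit_set_disc:
  assumes x0: "x0 \<in> uhp" and x: "Some x \<in> limit_set \<Gamma> x0"
  shows "\<exists>j. j \<noteq> 0 \<and> of_real x \<in> disc j"
proof -
  obtain p where p: "\<And>n. p n \<in> orbit \<Gamma> x0" "p \<longlonglongrightarrow> complex_of_real x"
    using x unfolding limit_set_def conv_bdry_def by auto
  have "\<forall>n. \<exists>A\<in>\<Gamma>. p n = act A x0" using p(1) unfolding orbit_def by blast
  then obtain A where A: "\<And>n. A n \<in> \<Gamma>" "\<And>n. p n = act (A n) x0" by metis
  have det: "det (A n) = 1" for n using A(1) wgroup_det by (auto simp: \<Gamma>_def)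
  \<comment> \<open>From |c|, |d| \<le> |ci + d| the denominator at \<open>x0\<close> is at most
    \<open>cmod x0 + 1\<close> times that at \<i>; \<open>Im_act\<close> turns the squared
    denominator into a height.\<close>
  define K where "K = (cmod x0 + 1) * cmod (x0 - \<i>) / Im x0"
  have I0: "Im x0 > 0" using x0 by (simp add: uhp_def)
  have close: "cmod (act (A n) \<i> - p n) \<le> K * Im (p n)" for n
  proof -
    let ?d = "cmod (den (A n) x0)" and ?e = "cmod (den (A n) \<i>)"
    have nz: "den (A n) x0 \<noteq> 0" "den (A n) \<i> \<noteq> 0" using den_uhp[OF det] x0 ii_uhp by auto
    have e: "\<bar>A n$2$1\<bar> \<le> ?e" "\<bar>A n$2$2\<bar> \<le> ?e"
      using abs_Re_le_cmod[of "den (A n) \<i>"] abs_Im_le_cmod[of "den (A n) \<i>"] by (auto simp: den_def)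
    have "?d \<le> \<bar>A n$2$1\<bar> * cmod x0 + \<bar>A n$2$2\<bar>"
      unfolding den_def by (rule order_trans[OF norm_triangle_ineq]) (simp add: norm_mult)
    also have "\<dots> \<le> ?e * cmod x0 + ?e" using e by (intro add_mono mult_right_mono) auto
    finally have de: "?d \<le> ?e * (cmod x0 + 1)" by (simp add: algebra_simps)
    have "cmod (act (A n) \<i> - p n) = cmod (x0 - \<i>) / (?e * ?d)"
      unfolding A(2) act_diff[OF det nz(2,1)] norm_divide norm_mult by (simp add: norm_minus_commute)
    also have "\<dots> \<le> (cmod x0 + 1) * cmod (x0 - \<i>) / (?d * ?d)"
    proof -
      have "?d / (cmod x0 + 1) \<le> ?e" using de by (simp add: divide_le_eq add_nonneg_pos)
      then have "cmod (x0 - \<i>) / (?e * ?d) \<le> cmod (x0 - \<i>) / (?d / (cmod x0 + 1) * ?d)"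
        using nz by (intro divide_left_mono mult_right_mono mult_pos_pos divide_pos_pos add_nonneg_pos) auto
      then show ?thesis by (simp add: mult.commute)
    qed
    also have "\<dots> = K * Im (p n)"
      unfolding A(2) Im_act[OF det x0] K_def using I0 nz by (simp add: power2_eq_square)
    finally show ?thesis .
  qed
  have "(\<lambda>n. K * Im (p n)) \<longlonglongrightarrow> K * Im (complex_of_real x)"
    using p(2) by (intro tendsto_intros)
  then have "(\<lambda>n. act (A n) \<i> - p n) \<longlonglongrightarrow> 0"
    by (intro Lim_null_comparison[OF always_eventually[OF allI[OF close]]]) simp
  from tendsto_add[OF this p(2)] have lim: "(\<lambda>n. act (A n) \<i>) \<longlonglongrightarrow> of_real x" by simp
  then have "eventually (\<lambda>n. dist (act (A n) \<i>) (of_real x) < 1/2) sequentially"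
    by (rule tendstoD) simp
  then obtain M where M: "\<And>n. n \<ge> M \<Longrightarrow> dist (act (A n) \<i>) (of_real x) < 1/2"
    by (auto simp: eventually_sequentially)
  have ex: "\<exists>j. j \<noteq> 0 \<and> act (A n) \<i> \<in> disc j" if "n \<ge> M" for n
  proof -
    have "act (A n) \<i> = \<i> \<or> (\<exists>j\<in>-{0}. act (A n) \<i> \<in> disc j)"
      using wgroup_orbit_ii A(1) by (auto simp: \<Gamma>_def)
    moreover have "act (A n) \<i> \<noteq> \<i>"
      using M[OF that] abs_Im_le_cmod[of "\<i> - of_real x"] by (auto simp: dist_norm)
    ultimately show ?thesis by blast
  qed
  obtain j where j: "j \<noteq> 0" "act (A M) \<i> \<in> disc j" using ex[of M] by auto
  have "act (A n) \<i> \<in> disc j" if n: "n \<ge> M" for n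
  proof -
    obtain k where k: "k \<noteq> 0" "act (A n) \<i> \<in> disc k" using ex[OF n] by auto
    have "k = j"
    proof (rule ccontr)
      assume "k \<noteq> j"
      then have "cmod (act (A n) \<i> - of_real (cen j)) \<ge> 5/4" using disc_far[OF k(1) j(1) _ k(2)] by blast
      moreover have "cmod (act (A M) \<i> - of_real (cen j)) \<le> 1/4"
        using j disc_radius_le[OF j(1)] unfolding mem_disc by linarith
      moreover have "dist (act (A n) \<i>) (act (A M) \<i>) < 1"
        using M[OF n] M[of M] by (metis dist_triangle_half_l order_refl)
      ultimately show False
        using dist_triangle[of "act (A n) \<i>" "of_real (cen j)" "act (A M) \<i>"] by (simp add: dist_norm)
    qed
    with k show ?thesis by simp
  qed
  then have "eventually (\<lambda>n. act (A n) \<i> \<in> disc j) sequentially" by (auto simp: eventually_sequentially)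
  then have "of_real x \<in> disc j"
    by (rule Lim_in_closed_set[rotated 1, OF _ _ lim]) (auto simp: disc_def)
  with j show ?thesis by blast
qed

lemma limit_set_fr:
  assumes x0: "x0 \<in> uhp" and x: "Some x \<in> limit_set \<Gamma> x0" and j: "j \<noteq> 0" "x \<noteq> cen j"
  shows "Some (fr (- j) x) \<in> limit_set \<Gamma> x0"
proof -
  obtain p where p: "\<And>n. p n \<in> orbit \<Gamma> x0" "p \<longlonglongrightarrow> complex_of_real x"
    using x unfolding limit_set_def conv_bdry_def by auto
  have "den (gen (- j)) (of_real x) \<noteq> 0" using den_gen[of "- j" "of_real x"] j by simp
  then have "(\<lambda>n. act (gen (- j)) (p n)) \<longlonglongrightarrow> act (gen (- j)) (of_real x)"
    unfolding act_def den_def using p(2) by (intro tendsto_intros)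
  moreover have "act (gen (- j)) (p n) \<in> orbit \<Gamma> x0" for n
  proof -
    obtain A where A: "A \<in> \<Gamma>" "p n = act A x0" using p(1)[of n] unfolding orbit_def by blast
    have "det A = 1" using A(1) wgroup_det by (auto simp: \<Gamma>_def)
    then have "act (gen (- j)) (p n) = act (gen (- j) ** A) x0"
      unfolding A(2) using act_mult den_uhp x0 by simp
    moreover have "gen (- j) ** A \<in> \<Gamma>"
      using A(1) gen_in_\<Gamma>[of "- j"] j(1) wgroup_mult by (auto simp: \<Gamma>_def)
    ultimately show ?thesis unfolding orbit_def by blast
  qed
  ultimately show ?thesis unfolding limit_set_def conv_bdry_def
    by (intro CollectI exI[of _ "\<lambda>n. act (gen (- j)) (p n)"]) (auto simp: of_real_fr)
qed

text \<open>Locate the point in a disc, undo that letter, and remain in the limit set by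
  \<open>limit_set_fr\<close>. This stops only at a centre, the point that the next step would send
  to infinity.\<close>

lemma limit_set_coding:
  assumes x0: "x0 \<in> uhp" and x: "Some x \<in> limit_set \<Gamma> x0"
  shows "(\<exists>k. x \<in> (prepend ^^ k) (range cen)) \<or> (\<exists>l y. itinerary x l y)"
proof -
  define lt where "lt u = (SOME j. j \<noteq> 0 \<and> complex_of_real u \<in> disc j)" for u
  define y where "y k = ((\<lambda>u. fr (- lt u) u) ^^ k) x" for k
  have y0: "y 0 = x" and yS: "y (Suc k) = fr (- lt (y k)) (y k)" for k by (simp_all add: y_def)
  have lt: "lt u \<noteq> 0 \<and> complex_of_real u \<in> disc (lt u)" if "Some u \<in> limit_set \<Gamma> x0" for u
    unfolding lt_def by (rule someI_ex) (rule limit_set_disc[OF x0 that])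
  show ?thesis
  proof (cases "\<exists>k. y k = cen (lt (y k))")
    case True
    then obtain k where k: "y k = cen (lt (y k))" "\<And>i. i < k \<Longrightarrow> y i \<noteq> cen (lt (y i))"
      using exists_least_iff[of "\<lambda>k. y k = cen (lt (y k))"] by auto
    have L: "i \<le> k \<Longrightarrow> Some (y i) \<in> limit_set \<Gamma> x0" for i
    proof (induction i)
      case (Suc i)
      then have "Some (y i) \<in> limit_set \<Gamma> x0" "y i \<noteq> cen (lt (y i))" using k(2) by auto
      then show ?case unfolding yS using limit_set_fr[OF x0] lt by blast
    qed (simp add: y0 x)
    have "y 0 \<in> (prepend ^^ k) (range cen)"
      by (rule mem_prepend_funpow[where l = "\<lambda>i. lt (y i)"]) (use k L lt yS in auto)
    then show ?thesis using y0 by auto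
  next
    case False
    have L: "Some (y i) \<in> limit_set \<Gamma> x0" for i
    proof (induction i)
      case (Suc i)
      then show ?case unfolding yS using limit_set_fr[OF x0] lt False by blast
    qed (simp add: y0 x)
    have "itinerary x (\<lambda>k. lt (y k)) y"
      unfolding itinerary_def using y0 yS lt[OF L] False by auto
    then show ?thesis by blast
  qed
qed

section \<open>Recurrence\<close>

definition scaleIm :: "real \<Rightarrow> complex \<Rightarrow> complex" where
  "scaleIm e z = Complex (Re z) (e * Im z)"

lemma scaleIm_affine:
  "scaleIm e (of_real a * z + of_real b) = of_real a * scaleIm e z + of_real b"
  by (simp add: scaleIm_def complex_eq_iff)

text \<open>In the coordinate \<open>1 / (y - w)\<close> the geodesics ending at \<open>y\<close> are the vertical lines.\<close>
lemma inverse_diff_act: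
  assumes A: "det A = 1" and y: "den A (of_real y) \<noteq> 0" and w: "w \<in> uhp"
  shows "1 / (act A (of_real y) - act A w) =
    (den A (of_real y))^2 * (1 / (of_real y - w)) + - of_real (A$2$1) * den A (of_real y)"
proof -
  have ne: "of_real y - w \<noteq> 0" using w by (auto simp: uhp_def complex_eq_iff)
  have dw: "den A w = den A (of_real y) - of_real (A$2$1) * (of_real y - w)"
    by (simp add: den_def algebra_simps)
  have "den A (of_real y) * den A w / (of_real y - w) =
      (den A (of_real y))^2 * (1 / (of_real y - w)) + - of_real (A$2$1) * den A (of_real y)"
    unfolding dw using ne by (simp add: field_simps power2_eq_square)
  then show ?thesis unfolding act_diff[OF A y den_uhp[OF A w]] by simp
qed

lemma den_of_real: "den A (of_real y) = of_real (A$2$1 * y + A$2$2)"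
  by (simp add: den_def)

text \<open>By \<open>inverse_diff_act\<close> the map acts on the coordinate
  \<open>1 / (y - w)\<close> as a real affine map, and scaling heights commutes with those. So rays
  are carried to rays with the same time parameter.\<close>

lemma scaleIm_act:
  assumes A: "det A = 1" and y: "den A (of_real y) \<noteq> 0" and w: "w \<in> uhp" and z: "z \<in> uhp"
    and eq: "1 / (of_real y - w) = scaleIm e (1 / (of_real y - z))"
  shows "1 / (act A (of_real y) - act A w) = scaleIm e (1 / (act A (of_real y) - act A z))"
proof -
  define d where "d = A$2$1 * y + A$2$2"
  have ca: "(den A (of_real y))^2 * u + - of_real (A$2$1) * den A (of_real y)
      = of_real (d^2) * u + of_real (- A$2$1 * d)" for u
    by (simp add: den_of_real d_def)
  show ?thesis
    unfolding inverse_diff_act[OF A y w] inverse_diff_act[OF A y z] ca scaleIm_affine eq ..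
qed

lemma hdist_vertical:
  assumes "q > 0"
  shows "hdist (Complex p (exp s * q)) (Complex p (exp t * q)) = \<bar>s - t\<bar>"
proof -
  have n: "cmod (Complex p (exp s * q) - Complex p (exp t * q)) ^ 2 = (exp s - exp t)^2 * q^2"
    unfolding cmod_power2 by (simp add: power_mult_distrib flip: left_diff_distrib)
  have "1 + (exp s - exp t)^2 * q^2 / (2 * (exp s * q) * (exp t * q)) = 1 + (exp s - exp t)^2 / (2 * exp s * exp t)"
    using assms by (simp add: power2_eq_square)
  also have "\<dots> = cosh (s - t)"
    by (simp add: cosh_def exp_diff exp_minus field_simps power2_eq_square)
  also have "\<dots> = cosh \<bar>s - t\<bar>" using cosh_minus[of "s - t"] by (simp add: abs_if)
  finally show ?thesis unfolding hdist_def n complex.sel by (simp only: arcosh_cosh_real abs_ge_zero)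
qed

text \<open>The geodesic from \<open>z\<close> to \<open>x\<close> at time \<open>t\<close>: the
  coordinate 1/(x - w) sends \<open>x\<close> to infinity and preserves the half-plane, where the
  ray climbs vertically at unit speed.\<close>

definition ray :: "complex \<Rightarrow> real \<Rightarrow> real \<Rightarrow> complex" where
  "ray z x t = of_real x - 1 / scaleIm (exp t) (1 / (of_real x - z))"

lemma Im_inverse_diff_pos:
  assumes "z \<in> uhp" shows "Im (1 / (of_real x - z)) > 0"
proof -
  have "Im z > 0" using assms by (simp add: uhp_def)
  then show ?thesis by (simp add: Im_divide) (metis add_nonneg_pos zero_le_power2 zero_less_power less_numeral_extra(3) power2_minus divide_pos_pos)
qed

lemma
  assumes z: "z \<in> uhp"
  shows ray_uhp: "ray z x t \<in> uhp"
    and inverse_diff_ray: "1 / (of_real x - ray z x t) = scaleIm (exp t) (1 / (of_real x - z))"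
    and geodesic_ray_ray: "geodesic_ray z (ray z x)"
    and ray_conv: "conv_bdry at_top (ray z x) (Some x)"
proof -
  define p q where "p = Re (1 / (of_real x - z))" and "q = Im (1 / (of_real x - z))"
  have q: "q > 0" unfolding q_def by (rule Im_inverse_diff_pos[OF z])
  define V where "V t = Complex p (exp t * q)" for t
  have sc: "scaleIm (exp t) (1 / (of_real x - z)) = V t" for t
    by (simp add: scaleIm_def V_def p_def q_def)
  have V: "V t \<in> uhp" "V t \<noteq> 0" for t using q by (auto simp: V_def uhp_def complex_eq_iff)
  have ray: "ray z x t = act (mk2 x (-1) 1 0) (V t)" for t
    using V(2)[of t] by (simp add: ray_def sc act_def diff_divide_distrib)
  have det: "det (mk2 x (-1) 1 0) = 1" by (simp add: det_2)
  show uhp: "ray z x t \<in> uhp" for t unfolding ray by (rule act_uhp[OF det V(1)])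
  show "1 / (of_real x - ray z x t) = scaleIm (exp t) (1 / (of_real x - z))"
    by (simp add: ray_def)
  have "ray z x 0 = z" by (simp add: ray_def scaleIm_def complex_eq_iff[symmetric])
  moreover have "hdist (ray z x s) (ray z x t) = \<bar>s - t\<bar>" for s t
    unfolding ray hdist_act[OF det V(1) V(1)] unfolding V_def by (rule hdist_vertical[OF q])
  ultimately show "geodesic_ray z (ray z x)" unfolding geodesic_ray_def using uhp by blast
  have "((\<lambda>t. 1 / V t) \<longlongrightarrow> 0) at_top"
  proof (rule Lim_null_comparison)
    show "\<forall>\<^sub>F t in at_top. cmod (1 / V t) \<le> exp (- t) / q"
    proof (rule always_eventually, rule allI)
      fix t
      have "exp t * q \<le> cmod (V t)" using abs_Im_le_cmod[of "V t"] q by (simp add: V_def)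
      then have "1 / cmod (V t) \<le> 1 / (exp t * q)" using q V(2)[of t] by (intro divide_left_mono) auto
      then show "cmod (1 / V t) \<le> exp (- t) / q" by (simp add: norm_divide exp_minus field_simps)
    qed
    have "((\<lambda>t::real. exp (- t) / q) \<longlongrightarrow> 0 / q) at_top"
      using q by (intro tendsto_divide tendsto_const filterlim_compose[OF exp_at_bot filterlim_uminus_at_bot_at_top]) auto
    then show "((\<lambda>t::real. exp (- t) / q) \<longlongrightarrow> 0) at_top" by simp
  qed
  then have "((\<lambda>t. of_real x - 1 / V t) \<longlongrightarrow> of_real x - 0) at_top" by (intro tendsto_diff tendsto_const)
  then show "conv_bdry at_top (ray z x) (Some x)" unfolding conv_bdry_def by (simp add: ray_def[abs_def] sc)
qed

text \<open>A ray from a low point of height \<eta> is, at time -ln \<eta>, at bounded height above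
  nearly the same place. With d = y - Re z one gets Im w = (d^2 + \<eta>^2)/(d^2 + 1), at least 1/5
  since d^2 \<ge> 1/4, and Re w - Re z = d(1 - \<eta>^2)/(d^2 + 1), at most 1/2 in absolute value
  since 2|d| \<le> d^2 + 1.\<close>

lemma ray_near_foot:
  assumes z: "z \<in> uhp" "Im z \<le> 1" and e: "\<bar>y - Re z\<bar> \<ge> 1/2"
    and eq: "1 / (of_real y - w) = scaleIm (1 / Im z) (1 / (of_real y - z))"
  shows "Im w \<ge> 1/5" "Im w \<le> 1" "\<bar>Re w - Re z\<bar> \<le> 1/2"
proof -
  define \<eta> where "\<eta> = Im z"
  define d where "d = y - Re z"
  have \<eta>: "0 < \<eta>" "\<eta> \<le> 1" using z by (auto simp: uhp_def \<eta>_def)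
  have d: "d^2 \<ge> 1/4" using power_mono[OF e, of 2] by (simp add: d_def power2_eq_square)
  define n where "n = d^2 + \<eta>^2"
  have n: "n > 0" using \<eta> by (simp add: n_def add_nonneg_pos)
  have "1 / (of_real y - z) = Complex (d / n) (\<eta> / n)"
    by (simp add: complex_eq_iff Re_divide Im_divide d_def \<eta>_def n_def power2_eq_square)
  then have "1 / (of_real y - w) = Complex (d / n) (1 / n)"
    using \<eta> unfolding eq scaleIm_def \<eta>_def[symmetric] by simp
  then have "of_real y - w = 1 / Complex (d / n) (1 / n)" by (metis div_by_1 divide_divide_eq_right mult_1)
  also have "\<dots> = Complex (d * n / (d^2 + 1)) (- n / (d^2 + 1))"
    using n by (simp add: complex_eq_iff Re_divide Im_divide power2_eq_square field_simps)
  finally have w: "w = of_real y - Complex (d * n / (d^2 + 1)) (- n / (d^2 + 1))" by (simp add: algebra_simps)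
  have p: "d^2 + 1 > 0" by (simp add: add_nonneg_pos)
  have Im: "Im w = n / (d^2 + 1)" by (simp add: w)
  have "\<eta>^2 \<le> 1" using \<eta> by (simp add: power_le_one)
  then show "Im w \<le> 1" unfolding Im n_def using p by (simp add: divide_le_eq)
  show "Im w \<ge> 1/5" unfolding Im n_def
  proof (subst le_divide_eq, simp only: p if_True)
    have "1 / 5 * (d^2 + 1) = d^2 / 5 + 1 / 5" by (simp add: field_simps)
    with d zero_le_power2[of \<eta>] show "1 / 5 * (d^2 + 1) \<le> d^2 + \<eta>^2" by linarith
  qed
  have "Re w - Re z = d - d * n / (d^2 + 1)" by (simp add: w d_def)
  also have "\<dots> = d * (1 - \<eta>^2) / (d^2 + 1)" using p by (simp add: n_def field_simps)
  finally have R: "\<bar>Re w - Re z\<bar> = \<bar>d\<bar> * (1 - \<eta>^2) / (d^2 + 1)"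
    using p \<open>\<eta>\<^sup>2 \<le> 1\<close> by (simp add: abs_mult)
  have "\<bar>d\<bar> * (1 - \<eta>^2) \<le> \<bar>d\<bar> * 1" by (intro mult_left_mono) auto
  moreover have "2 * \<bar>d\<bar> \<le> d^2 + 1" using zero_le_power2[of "\<bar>d\<bar> - 1"] by (simp add: power2_diff)
  ultimately show "\<bar>Re w - Re z\<bar> \<le> 1/2" unfolding R using p by (simp add: divide_simps)
qed

section \<open>Distance estimates and return times\<close>

lemma arcosh_mono:
  assumes "1 \<le> a" "a \<le> b" shows "arcosh a \<le> arcosh (b::real)"
  using assms by (cases "a = b") (auto intro: less_imp_le)

lemma hdist_nonneg: "z \<in> uhp \<Longrightarrow> w \<in> uhp \<Longrightarrow> hdist z w \<ge> 0"
  unfolding hdist_def uhp_def by (intro arcosh_nonneg_real) auto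

text \<open>As long as \<open>z k\<close> is within 1/2 of \<open>cen (l k)\<close>, undoing a
  letter at least doubles its distance from \<open>y k\<close>, which stays below 1; so this cannot
  last. Once the distance from the centre is at least 1/2, the next image is within 1/2 of
  \<open>cen (- l k)\<close>, hence at least 1 from the next centre, which is a different one; this
  then repeats for ever.\<close>

lemma escape:
  assumes it: "itinerary x l y" and z: "\<And>k. z k \<in> uhp" "\<And>k. z (Suc k) = act (gen (- l k)) (z k)"
  shows "\<exists>K. \<forall>k\<ge>K. cmod (z k - of_real (cen (l k))) \<ge> 1"
proof -
  note D = itineraryD[OF it]
  have den: "cmod (den (gen (- l k)) u) = \<bar>of_int (gc (l k))\<bar> * cmod (u - of_real (cen (l k)))" for k u
    using norm_den_gen[of "- l k" u] D(2) by simp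
  have zne: "z k \<noteq> of_real u" for k u using z(1)[of k] by (auto simp: uhp_def)
  have "\<exists>k. cmod (z k - of_real (cen (l k))) \<ge> 1/2"
  proof (rule ccontr)
    assume "\<not> ?thesis"
    then have near: "cmod (z k - of_real (cen (l k))) < 1/2" for k by (simp add: not_le)
    have grow: "cmod (z k - of_real (y k)) \<ge> 2 ^ k * cmod (z 0 - of_real (y 0))" for k
    proof (induction k)
      case (Suc k)
      let ?c = "\<bar>real_of_int (gc (l k))\<bar>"
      have c: "?c > 0" using D(2)[of k] by simp
      let ?a = "cmod (den (gen (- l k)) (z k))" and ?b = "cmod (den (gen (- l k)) (of_real (y k)))"
      have nz: "den (gen (- l k)) (z k) \<noteq> 0" "den (gen (- l k)) (of_real (y k)) \<noteq> 0"
        using den_uhp[OF det_gen z(1)] den_gen[of "- l k" "of_real (y k)"] D(2,4) by auto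
      \<comment> \<open>One denominator is at most c/2 by nearness, the other at most 1/c because
        the disc has radius 1/c^2; their product 1/2 is the doubling.\<close>
      have "?a \<le> ?c * (1/2)" unfolding den using near[of k] c by (intro mult_left_mono) auto
      moreover have "?b \<le> ?c * (1 / (of_int (gc (l k)))^2)"
        unfolding den using D(3)[of k] c unfolding mem_disc by (intro mult_left_mono) auto
      ultimately have "?a * ?b \<le> ?c * (1/2) * (?c * (1 / (of_int (gc (l k)))^2))"
        by (intro mult_mono) auto
      also have "\<dots> = 1/2" using c by (simp add: power2_eq_square)
      finally have ab: "?a * ?b \<le> 1/2" .
      have "cmod (z (Suc k) - of_real (y (Suc k))) = cmod (z k - of_real (y k)) / (?a * ?b)"
        unfolding z(2) D(5) of_real_fr act_diff[OF det_gen nz] norm_divide norm_mult ..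
      also have "\<dots> \<ge> cmod (z k - of_real (y k)) / (1/2)"
        using ab nz by (intro divide_left_mono mult_pos_pos) auto
      finally show ?case using Suc by simp
    qed simp
    have "cmod (z k - of_real (y k)) \<le> 1" for k
    proof -
      have "cmod (of_real (y k) - of_real (cen (l k))) \<le> 1/4"
        using D(3)[of k] disc_radius_le[OF D(2), of k] unfolding mem_disc by linarith
      then show ?thesis using near[of k] norm_triangle_ineq4[of "z k - of_real (cen (l k))" "of_real (y k) - of_real (cen (l k))"]
        by simp
    qed
    then have le: "2 ^ k * cmod (z 0 - of_real (y 0)) \<le> 1" for k using grow[of k] by (meson order_trans)
    have pos: "cmod (z 0 - of_real (y 0)) > 0" using zne by simp
    obtain k where "1 / cmod (z 0 - of_real (y 0)) < 2 ^ k" using real_arch_pow[of 2] by auto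
    with le[of k] pos show False by (simp add: divide_simps mult.commute)
  qed
  then obtain K where K: "cmod (z K - of_real (cen (l K))) \<ge> 1/2" by blast
  have next_far: "cmod (z (Suc k) - of_real (cen (l (Suc k)))) \<ge> 1"
    if far: "cmod (z k - of_real (cen (l k))) \<ge> 1/2" for k
  proof -
    have "cmod (z (Suc k) - of_real (cen (- l k))) = 1 / ((of_int (gc (l k)))^2 * cmod (z k - of_real (cen (l k))))"
      using norm_act_gen_diff_cen[of "- l k" "z k"] D(2) zne by (simp add: z(2))
    also have "\<dots> \<le> 1 / (4 * (1/2))"
      using far gc_sq_ge[OF D(2), of k] D(2)[of k] by (intro divide_left_mono mult_mono mult_pos_pos) auto
    finally have a: "cmod (z (Suc k) - of_real (cen (- l k))) \<le> 1/2" by simp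
    have "cmod (of_real (cen (l (Suc k))) - of_real (cen (- l k))) \<ge> 3/2"
      unfolding norm_of_real_diff using cen_dist[of "l (Suc k)" "- l k"] D(2) itinerary_next_ne[OF it] by simp
    then show ?thesis
      using a dist_triangle3[of "complex_of_real (cen (l (Suc k)))" "of_real (cen (- l k))" "z (Suc k)"]
      unfolding dist_norm by linarith
  qed
  have "cmod (z k - of_real (cen (l k))) \<ge> 1" if "k \<ge> Suc K" for k
    using that
  proof (induction k rule: dec_induct)
    case base show ?case by (rule next_far[OF K])
  next
    case (step n) show ?case by (rule next_far) (use step in simp)
  qed
  then show ?thesis by blast
qed

lemma orbit_dist_le:
  assumes H: "H \<in> \<Gamma>" and x0: "x0 \<in> uhp" and p: "p \<in> uhp"
  shows "orbit_dist \<Gamma> x0 p \<le> hdist (act H p) x0"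
proof -
  have det: "A \<in> \<Gamma> \<Longrightarrow> det A = 1" for A using wgroup_det by (auto simp: \<Gamma>_def)
  have inv: "matrix_inv H \<in> \<Gamma>" using \<Gamma>_subgroup H unfolding sl2_subgroup_def by blast
  have "H ** matrix_inv H = mat 1"
    using det[OF H] invertible_det_nz[of H] unfolding invertible_def matrix_inv_def
    by (metis (mono_tags, lifting) someI_ex zero_neq_one)
  then have "act H (act (matrix_inv H) x0) = x0"
    using act_mult[OF den_uhp[OF det[OF inv] x0], of H] by simp
  then have eq: "hdist (act H p) x0 = hdist p (act (matrix_inv H) x0)"
    using hdist_act[OF det[OF H] p act_uhp[OF det[OF inv] x0]] by simp
  have "bdd_below ((\<lambda>q. hdist p q) ` orbit \<Gamma> x0)"
    by (rule bdd_belowI2[of _ 0]) (auto simp: orbit_def intro!: hdist_nonneg p act_uhp det x0)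
  then show ?thesis unfolding orbit_dist_def eq
    by (intro cInf_lower) (use inv in \<open>auto simp: orbit_def\<close>)
qed

lemma hdist_bound:
  assumes w: "Im w \<ge> 1/5" "Im w \<le> 1" "\<bar>Re w\<bar> \<le> R" and x0: "x0 \<in> uhp"
  shows "hdist w x0 \<le> arcosh (1 + (R + 1 + cmod x0)^2 / (2 * (1/5) * Im x0))"
  unfolding hdist_def
proof (rule arcosh_mono)
  have I0: "Im x0 > 0" using x0 by (simp add: uhp_def)
  have "cmod w \<le> R + 1" using cmod_le[of w] w by linarith
  then have "cmod (w - x0) \<le> R + 1 + cmod x0" using norm_triangle_ineq4[of w x0] by linarith
  then have "(cmod (w - x0))^2 \<le> (R + 1 + cmod x0)^2" by (rule power_mono) simp
  then show "1 + (cmod (w - x0))^2 / (2 * Im w * Im x0) \<le> 1 + (R + 1 + cmod x0)^2 / (2 * (1/5) * Im x0)"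
    using w I0 by (intro add_left_mono frac_le mult_mono) auto
  show "1 \<le> 1 + (cmod (w - x0))^2 / (2 * Im w * Im x0)" using w I0 by simp
qed

lemma abs_cen_le: "j \<noteq> 0 \<Longrightarrow> \<bar>cen j\<bar> \<le> 2 * \<bar>of_int j\<bar> + 1"
proof -
  assume j: "j \<noteq> 0"
  have "\<bar>1 / real_of_int (gc j)\<bar> \<le> 1" using abs_gc_ge[OF j] by (simp add: abs_divide divide_simps)
  then show ?thesis unfolding cen_def by linarith
qed

text \<open>The elements \<open>H k\<close> undo the first letters and carry the ray from
  \<open>x0\<close> to \<open>x\<close> to the ray from \<open>z k\<close> to \<open>y k\<close>.
  After \<open>escape\<close> the heights of \<open>z k\<close> drop by a factor 4 per step, so the
  times of \<open>ray_near_foot\<close> tend to infinity. A letter below \<open>N\<close> also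
  bounds the real part at such a time, so the orbit distance is bounded by \<open>B\<close>
  arbitrarily late.\<close>

lemma recurrent_not_transient:
  assumes it: "itinerary x l y" and x0: "x0 \<in> uhp" and inf: "\<And>K. \<exists>k\<ge>K. \<bar>l k\<bar> < int N"
  shows "Some x \<notin> transient_limit_set \<Gamma> x0"
proof
  assume "Some x \<in> transient_limit_set \<Gamma> x0"
  then have lim: "filterlim (\<lambda>t. orbit_dist \<Gamma> x0 (ray x0 x t)) at_top at_top"
    using geodesic_ray_ray[OF x0] ray_conv[OF x0] unfolding transient_limit_set_def by blast
  note D = itineraryD[OF it]
  define H where "H k = rec_nat (mat 1) (\<lambda>k A. gen (- l k) ** A) k" for k
  have H: "H 0 = mat 1" "H (Suc k) = gen (- l k) ** H k" for k by (simp_all add: H_def)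
  have H\<Gamma>: "H k \<in> \<Gamma>" for k
  proof (induction k)
    case 0 show ?case by (simp add: H \<Gamma>_def wgroup_ids)
  next
    case (Suc k)
    then show ?case unfolding H \<Gamma>_def by (intro wgroup_mult gen_in_wgroup) (use D(2) in auto)
  qed
  have det: "det (H k) = 1" for k using H\<Gamma> wgroup_det by (auto simp: \<Gamma>_def)
  have Hs: "act (H (Suc k)) u = act (gen (- l k)) (act (H k) u)" if "u \<in> uhp" for k u
    unfolding H using act_mult den_uhp[OF det that] by simp
  define z where "z k = act (H k) x0" for k
  have z: "z k \<in> uhp" "z (Suc k) = act (gen (- l k)) (z k)" for k
    unfolding z_def using act_uhp[OF det x0] Hs[OF x0] by auto
  have eq: "1 / (of_real (y k) - act (H k) (ray x0 x t)) = scaleIm (exp t) (1 / (of_real (y k) - z k))" for k t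
  proof (induction k)
    case 0 then show ?case using inverse_diff_ray[OF x0] by (simp add: z_def H D(1))
  next
    case (Suc k)
    have "den (gen (- l k)) (of_real (y k)) \<noteq> 0" using den_gen[of "- l k" "of_real (y k)"] D(2,4) by simp
    then show ?case
      unfolding Hs[OF ray_uhp[OF x0]] z(2) D(5) of_real_fr
      by (intro scaleIm_act det_gen act_uhp det ray_uhp x0 z(1) Suc)
  qed
  obtain K where K: "\<And>k. k \<ge> K \<Longrightarrow> cmod (z k - of_real (cen (l k))) \<ge> 1"
    using escape[OF it z] by blast
  have Im_dec: "Im (z (Suc k)) \<le> Im (z k) / 4" if "k \<ge> K" for k
  proof -
    have "2 * 1 \<le> \<bar>of_int (gc (l k))\<bar> * cmod (z k - of_real (cen (l k)))"
      using K[OF that] abs_gc_ge[OF D(2), of k] by (intro mult_mono) auto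
    then have "cmod (den (gen (- l k)) (z k)) \<ge> 2" using norm_den_gen[of "- l k" "z k"] D(2) by simp
    then have "(cmod (den (gen (- l k)) (z k)))^2 \<ge> 4" using power_mono[of 2 _ 2] by fastforce
    then show ?thesis unfolding z(2) Im_act[OF det_gen z(1)] using z(1)[of k]
      by (intro divide_left_mono) (auto simp: uhp_def)
  qed
  have Im_bound: "Im (z (K + n)) \<le> Im (z K) / 4 ^ n" for n
  proof (induction n)
    case (Suc n)
    have "Im (z (K + Suc n)) \<le> Im (z (K + n)) / 4" using Im_dec[of "K + n"] by simp
    also have "\<dots> \<le> Im (z K) / 4 ^ n / 4" using Suc by (rule divide_right_mono) simp
    finally show ?case by (simp add: mult.commute)
  qed simp
  \<comment> \<open>The real part of the moved point is within 1/2 of that of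
    \<open>z (Suc k)\<close>, itself within 1/4 of \<open>cen (- l k)\<close>, whose size is at most
    2N + 1; this gives 2N + 2.\<close>
  define B where "B = arcosh (1 + ((2 * real N + 2) + 1 + cmod x0)^2 / (2 * (1/5) * Im x0))"
  have "eventually (\<lambda>t. orbit_dist \<Gamma> x0 (ray x0 x t) > B) at_top"
    using lim by (simp add: filterlim_at_top_dense)
  then obtain T where T: "\<And>t. t \<ge> T \<Longrightarrow> orbit_dist \<Gamma> x0 (ray x0 x t) > B"
    by (auto simp: eventually_at_top_linorder)
  have "(\<lambda>n. Im (z K) * (1/4) ^ n) \<longlonglongrightarrow> Im (z K) * 0"
    by (intro tendsto_mult tendsto_const LIMSEQ_realpow_zero) auto
  \<comment> \<open>Height at most 1 is a hypothesis of \<open>ray_near_foot\<close>; height below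
    \<open>exp (- T)\<close> puts the return time past \<open>T\<close>.\<close>
  then have "eventually (\<lambda>n. Im (z K) * (1/4) ^ n < min 1 (exp (- T))) sequentially"
    by (intro order_tendstoD(2)) auto
  then obtain n0 where n0: "\<And>n. n \<ge> n0 \<Longrightarrow> Im (z K) * (1/4) ^ n < min 1 (exp (- T))"
    by (auto simp: eventually_sequentially)
  obtain k where k: "k \<ge> K + n0" "\<bar>l k\<bar> < int N" using inf by blast
  let ?z = "z (Suc k)" and ?y = "y (Suc k)"
  define t where "t = - ln (Im ?z)"
  have Ipos: "Im ?z > 0" using z(1) by (simp add: uhp_def)
  have small: "Im ?z < min 1 (exp (- T))"
  proof -
    have "Im ?z \<le> Im (z K) * (1/4) ^ (Suc k - K)"
      using Im_bound[of "Suc k - K"] k(1) by (simp add: power_one_over)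
    also have "\<dots> < min 1 (exp (- T))" by (rule n0) (use k(1) in simp)
    finally show ?thesis .
  qed
  then have "ln (Im ?z) < - T" using Ipos by (metis exp_less_cancel_iff exp_ln min_less_iff_conj)
  then have tT: "t \<ge> T" by (simp add: t_def)
  have et: "exp t = 1 / Im ?z" using Ipos by (simp add: t_def exp_minus inverse_eq_divide)
  have zc: "cmod (?z - of_real (cen (- l k))) \<le> 1/4"
  proof -
    have "z k \<noteq> of_real (cen (l k))" using z(1)[of k] by (auto simp: uhp_def)
    then have "cmod (?z - of_real (cen (- l k))) = 1 / ((of_int (gc (l k)))^2 * cmod (z k - of_real (cen (l k))))"
      using norm_act_gen_diff_cen[of "- l k" "z k"] D(2) by (simp add: z(2))
    also have "\<dots> \<le> 1 / (4 * 1)"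
      using K[of k] k(1) gc_sq_ge[OF D(2), of k] D(2)[of k] by (intro divide_left_mono mult_mono mult_pos_pos) auto
    finally show ?thesis by simp
  qed
  then have Rz: "\<bar>Re ?z - cen (- l k)\<bar> \<le> 1/4" using abs_Re_le_cmod[of "?z - of_real (cen (- l k))"] by simp
  have e: "\<bar>?y - Re ?z\<bar> \<ge> 1/2" using Rz D(6)[of k] by linarith
  let ?w = "act (H (Suc k)) (ray x0 x t)"
  have "1 / (of_real ?y - ?w) = scaleIm (1 / Im ?z) (1 / (of_real ?y - ?z))"
    using eq[of "Suc k" t] unfolding et .
  note w = ray_near_foot[OF z(1) _ e this]
  have "\<bar>cen (- l k)\<bar> \<le> 2 * real N + 1"
  proof -
    have "\<bar>l k\<bar> + 1 \<le> int N" using k(2) by simp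
    then have "\<bar>real_of_int (l k)\<bar> + 1 \<le> real N" by linarith
    then show ?thesis using abs_cen_le[of "l k"] D(2) by simp
  qed
  then have "\<bar>Re ?w\<bar> \<le> 2 * real N + 2" using w(3) Rz small by linarith
  then have "hdist ?w x0 \<le> B" unfolding B_def using w(1,2) small by (intro hdist_bound x0) auto
  then have "orbit_dist \<Gamma> x0 (ray x0 x t) \<le> B"
    using orbit_dist_le[OF H\<Gamma> x0 ray_uhp[OF x0]] by (meson order_trans)
  with T[OF tT] show False by simp
qed

text \<open>\<open>N\<close> is free here so that it can be chosen after s. The two unions match the
  two cases of \<open>limit_set_coding\<close>; the first consists of the points that reach a centre
  after finitely many steps.\<close>

lemma transient_cover:
  assumes x0: "x0 \<in> uhp"
  shows "{x. Some x \<in> transient_limit_set \<Gamma> x0} \<subseteq> (\<Union>k. (prepend ^^ k) (range cen)) \<union> (\<Union>k. (prepend ^^ k) (tails N))"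
proof
  fix x assume "x \<in> {x. Some x \<in> transient_limit_set \<Gamma> x0}"
  then have x: "Some x \<in> transient_limit_set \<Gamma> x0" by simp
  then have "Some x \<in> limit_set \<Gamma> x0" unfolding transient_limit_set_def by blast
  from limit_set_coding[OF x0 this]
  show "x \<in> (\<Union>k. (prepend ^^ k) (range cen)) \<union> (\<Union>k. (prepend ^^ k) (tails N))"
  proof
    assume "\<exists>l y. itinerary x l y"
    then obtain l y where it: "itinerary x l y" by blast
    obtain K where K: "\<And>k. k \<ge> K \<Longrightarrow> int N \<le> \<bar>l k\<bar>"
      using recurrent_not_transient[OF it x0, of N] x by (meson not_le)
    have "y K \<in> tails N" unfolding tails_def
      using itinerary_shift[OF it, of K] K by (intro CollectI exI conjI) auto
    then have "y 0 \<in> (prepend ^^ K) (tails N)"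
      by (intro mem_prepend_funpow[of K l]) (use itineraryD[OF it] in blast)+
    then show ?thesis using itineraryD(1)[OF it] by blast
  qed blast
qed

lemma transient_null:
  assumes x0: "x0 \<in> uhp" and s: "s > 0"
  shows "hausdorff_null s {x. Some x \<in> transient_limit_set \<Gamma> x0}"
proof -
  obtain N where N: "hausdorff_null s (tails N)" using tails_null[OF s] by blast
  have "hausdorff_null s (\<Union>j. {cen j})"
    by (rule hausdorff_null_UN_countable) (auto simp: hausdorff_null_singleton)
  then have "hausdorff_null s (range cen)" by (rule hausdorff_null_subset) auto
  then show ?thesis
    by (intro hausdorff_null_subset[OF _ transient_cover[OF x0, of N]] hausdorff_null_Un hausdorff_null_UN
        prepend_funpow_null s N)
qed

theorem theorem2:
  shows "\<exists>G. fuchsian G \<and> torsion_free G \<and> \<not> finitely_generated G \<and>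
           (\<forall>x0\<in>uhp. bdry_hausdorff_dim (transient_limit_set G x0) = 0)"
proof (intro exI conjI ballI)
  show "fuchsian \<Gamma>" by (rule fuchsian_\<Gamma>)
  show "torsion_free \<Gamma>" by (rule torsion_free_\<Gamma>)
  show "\<not> finitely_generated \<Gamma>" by (rule not_finitely_generated_\<Gamma>)
  show "bdry_hausdorff_dim (transient_limit_set \<Gamma> x0) = 0" if "x0 \<in> uhp" for x0
    unfolding bdry_hausdorff_dim_def by (rule hausdorff_dim_eq_0[OF transient_null[OF that]])
qed

end
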